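(* Let $G$ be a Cayley graph of an infinite finitely generated group, let $o$ be the identity element, and let $C$ be the open connected component of $o$ under Bernoulli bond percolation on $G$. Then for every $p\in(0,1)$ the limit $$\lim_{n\to\infty} -\frac1n \log \mathbb{P}_p(|C|=n)$$ exists.
   Context: Cayley graph: given a finitely generated group $\bar G$ and a finite symmetric generating set $\mathcal S=\mathcal S^{-1}$, the (left-)Cayley graph has vertex set $\bar G$ and edge set $\{\{u,v\}: v=su \text{ for some } s\in\mathcal S\}$. Percolation: $\mathbb{P}_p$ is the probability measure on $\{0,1\}^{E(G)}$ under which the edge states are i.i.d. Bernoulli$(p)$; edges in state $1$ are open, and the open connected components (clusters) are the connected components of the subgraph with vertex set $V(G)$ and the open edges. $|C|$ denotes the number of vertices of $C$. *)

theory Defs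
  imports "HOL-Probability.Probability" "HOL-Algebra.Generated_Groups"
begin

(* Undirected edges are sets {u, v}; if the identity lies in S, the singletons {u} are loops. *)
definition cayley_edges :: "('a, 'b) monoid_scheme \<Rightarrow> 'a set \<Rightarrow> 'a set set" where
  "cayley_edges G S =
     {{u, v} | u v. u \<in> carrier G \<and> v \<in> carrier G \<and> (\<exists>s\<in>S. v = s \<otimes>\<^bsub>G\<^esub> u)}"

definition graph_component :: "'v set \<Rightarrow> 'v set set \<Rightarrow> 'v \<Rightarrow> 'v set" where
  "graph_component V F x =
     {y \<in> V. (x, y) \<in> {(u, v). u \<in> V \<and> v \<in> V \<and> {u, v} \<in> F}\<^sup>*}"

(* State 1 (open) is True. *)
definition bond_percolation :: "'e set \<Rightarrow> real \<Rightarrow> ('e \<Rightarrow> bool) measure" where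
  "bond_percolation E p = (\<Pi>\<^sub>M e\<in>E. measure_pmf (bernoulli_pmf p))"

definition open_cluster :: "'v set \<Rightarrow> 'v set set \<Rightarrow> ('v set \<Rightarrow> bool) \<Rightarrow> 'v \<Rightarrow> 'v set" where
  "open_cluster V E \<omega> x = graph_component V {e \<in> E. \<omega> e} x"

(* The finiteness conjunct matters only for n = 0, since card is 0 on infinite sets. *)
definition cluster_size_prob ::
  "('a, 'b) monoid_scheme \<Rightarrow> 'a set \<Rightarrow> real \<Rightarrow> nat \<Rightarrow> real" where
  "cluster_size_prob G S p n =
     \<P>(\<omega> in bond_percolation (cayley_edges G S) p.
        finite (open_cluster (carrier G) (cayley_edges G S) \<omega> \<one>\<^bsub>G\<^esub>) \<and>
        card (open_cluster (carrier G) (cayley_edges G S) \<omega> \<one>\<^bsub>G\<^esub>) = n)"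

end

theory Submission
  imports Defs
begin

text \<open>
  Call a finite, possibly empty set of edges that are all connected to a root vertex an \<^emph>\<open>animal\<close>. The event
  \<open>|C| = n\<close> is the disjoint union, over the animals \<open>F\<close> at the identity with \<open>n\<close> vertices, of the
  events that exactly the edges of \<open>F\<close> are open among all edges touching it. So \<open>\<P>(|C| = n)\<close> is
  a sum \<open>a n\<close> of weights \<open>p ^ |F| * (1 - p) ^ (number of closed edges touching F)\<close>
  (\<open>cluster_size_prob_eq_sum\<close>), and by a variant of Fekete's lemma
  (\<open>almost_subadditive_convergent\<close>) the limit exists once \<open>- ln (a n)\<close> is subadditive up to an
  error of order \<open>(n + m) powr (3/4)\<close> (\<open>log_almost_subadditive\<close>).

  For subadditivity, an animal with vertex set \<open>A\<close> is joined to a translate \<open>B g\<close> of an animal with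
  vertex set \<open>B\<close>; right translations are automorphisms of the left Cayley graph. On \<open>\<int>\<^sup>d\<close>
  one pushes \<open>B\<close> in a fixed direction until it is just about to leave \<open>A\<close>. In a general group, two
  neighbouring \<open>g\<close> may give translates far away from each other, so this breaks down. But an exact
  contact is more than is needed: it suffices that \<open>A \<inter> B g\<close> has few elements and that some
  short path joins \<open>A\<close> to \<open>B g\<close>, where few and short mean \<open>O(n powr (2/3))\<close> for sets with at most
  \<open>n\<close> elements. Such a \<open>g\<close> always exists (\<open>nearly_touching_translate\<close>), for one of two reasons.

  \<^item> Suppose that balls of radius \<open>k\<close> have at least \<open>c * k\<^sup>2\<close> elements. Let \<open>N\<close> be the
    number of \<open>g\<close> for which \<open>B g\<close> meets \<open>A\<close>. The average overlap over these \<open>g\<close> is at most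
    \<open>n\<^sup>2 / N\<close>, which is small if \<open>N\<close> is large. If \<open>N\<close> is small, then the set of these \<open>g\<close>
    cannot contain a ball of radius much larger than \<open>sqrt N\<close>, and this produces a translate
    disjoint from \<open>A\<close> at distance \<open>O(sqrt N)\<close>. The threshold \<open>N = n powr (4/3)\<close> balances the two.

  \<^item> Suppose that some \<open>z\<close> of infinite order has only finitely many conjugates. Then
    \<open>b z\<^sup>j\<^sup>+\<^sup>1 = (b z b\<^sup>-\<^sup>1) (b z\<^sup>j)\<close> shows that \<open>B z\<^sup>j\<close> moves by a bounded distance as \<open>j\<close> grows
    by one, and the argument for \<open>\<int>\<^sup>d\<close> applies.

  One of the two cases always occurs (\<open>growth_dichotomy\<close>). If some \<open>z\<close> has infinite order, then
  either the cyclic subgroup of \<open>z\<close> has finite index, so that \<open>z\<close> has finitely many conjugates, or a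
  ball of radius \<open>k\<close> meets more than \<open>k\<close> of its cosets, each in about \<open>k\<close> elements at comparable
  distance. If all orders are finite, shortlex-minimal words cannot be periodic, hence at
  least \<open>k + 1\<close> of them have length \<open>k\<close> (\<open>periodic_words\<close>).

  The union of \<open>A\<close>, \<open>B g\<close> and the path is again an animal, whose weight is at least the product of
  the two weights up to a factor exponential in the length of the path. The pair can be read off
  from the union together with \<open>g\<close> and the few edges of the union that touch \<open>A\<close> or \<open>B g\<close> without
  belonging to that part, so only subexponentially many pairs have the same union (\<open>merge_bound\<close>). The
  number of vertices of the union may differ from \<open>n + m\<close> by \<open>O((n + m) powr (2/3))\<close>, and
  it is corrected by adding or removing vertices one by one, at the price of a polynomial factor for
  each (\<open>step_up\<close>, \<open>step_down\<close>).
\<close>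

section \<open>Languages of low complexity\<close>

text \<open>
  A quantitative form of the Morse-Hedlund theorem for a language closed under factors. Restrict to the
  words that can be prolonged to the right arbitrarily far. Each of them has a prolongation by one
  letter of the same kind, so their number does not decrease with the length; if it stays at most
  \<open>r\<close> at length \<open>r\<close>, it is constant at some step \<open>j\<close>. Then the last \<open>j\<close> letters determine the next
  letter, and prolonging repeatedly runs into a cycle.
\<close>

lemma periodic_words:
  fixes L :: "'b list set"
  assumes finA: "finite A" and LA: "L \<subseteq> lists A" and infL: "infinite L"
    and factor: "\<And>u v w. u @ v @ w \<in> L \<Longrightarrow> v \<in> L"
    and few: "card {w \<in> L. length w = r} \<le> r"
  shows "\<exists>v. v \<noteq> [] \<and> (\<forall>m. concat (replicate m v) \<in> L)"
proof -
  define E where "E = {u. \<forall>M. \<exists>x. length x \<ge> M \<and> u @ x \<in> L}"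
  define EL where "EL j = {u \<in> E. length u = j}" for j
  have E_L: "u \<in> L" if "u \<in> E" for u
    using that factor[of "[]" u] unfolding E_def by fastforce
  have E_suffix: "b \<in> E" if ab: "a @ b \<in> E" for a b
    unfolding E_def
  proof (intro CollectI allI)
    fix M
    obtain x where x: "length x \<ge> M" "(a @ b) @ x \<in> L" using ab unfolding E_def by blast
    then have "b @ x \<in> L" using factor[of a "b @ x" "[]"] by simp
    then show "\<exists>x. M \<le> length x \<and> b @ x \<in> L" using x(1) by blast
  qed
  have E_Nil: "[] \<in> E"
  proof (rule ccontr)
    assume "[] \<notin> E"
    then obtain M where M: "\<And>x. x \<in> L \<Longrightarrow> length x < M"
      unfolding E_def by (auto simp: not_le)
    have "L \<subseteq> {xs. set xs \<subseteq> A \<and> length xs \<le> M}"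
      using M LA by (auto simp: less_imp_le)
    then show False using finite_lists_length_le[OF finA] infL finite_subset by blast
  qed
  have E_ext: "\<exists>s\<in>A. u @ [s] \<in> E" if u: "u \<in> E" for u
  proof (rule ccontr)
    assume "\<not> ?thesis"
    then have "\<forall>s\<in>A. \<exists>M. \<forall>x. length x \<ge> M \<longrightarrow> (u @ [s]) @ x \<notin> L"
      unfolding E_def by auto
    \<comment> \<open>if no letter works, then prolongations of \<open>u\<close> are bounded in length, one bound for each first letter\<close>
    then obtain Mf where Mf: "\<And>s x. s \<in> A \<Longrightarrow> length x \<ge> Mf s \<Longrightarrow> (u @ [s]) @ x \<notin> L"
      by metis
    obtain x where x: "length x \<ge> Suc (sum Mf A)" "u @ x \<in> L"
      using u unfolding E_def by blast
    then obtain s y where y: "x = s # y" by (cases x) auto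
    have "s \<in> A" using x(2) LA y by auto
    moreover have "Mf s \<le> length y"
      using member_le_sum[of s A Mf] finA \<open>s \<in> A\<close> x(1) y by auto
    ultimately show False using Mf x(2) y by simp
  qed
  define nxt where "nxt u = (SOME s. s \<in> A \<and> u @ [s] \<in> E)" for u
  have nxt: "u @ [nxt u] \<in> E" if "u \<in> E" for u
    using someI_ex[of "\<lambda>s. s \<in> A \<and> u @ [s] \<in> E"] E_ext[OF that] unfolding nxt_def by blast
  have ELL: "EL j \<subseteq> {w \<in> L. length w = j}" for j
    using E_L by (auto simp: EL_def)
  have finEL: "finite (EL j)" for j
    by (rule finite_subset[OF _ finite_lists_length_le[OF finA, of j]])
       (use E_L LA in \<open>auto simp: EL_def\<close>)
  have finL: "finite {w \<in> L. length w = j}" for j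
    by (rule finite_subset[OF _ finite_lists_length_le[OF finA, of j]]) (use LA in auto)
  have fEL: "(\<lambda>u. u @ [nxt u]) ` EL j \<subseteq> EL (Suc j)" for j
    using nxt by (auto simp: EL_def)
  have finj: "inj_on (\<lambda>u. u @ [nxt u]) (EL j)" for j
    by (auto simp: inj_on_def)
  have ELne: "EL j \<noteq> {}" for j
  proof (induction j)
    case 0
    then show ?case using E_Nil by (auto simp: EL_def)
  next
    case (Suc j)
    then show ?case using fEL[of j] by blast
  qed
  have "\<exists>j. card (EL (Suc j)) \<le> card (EL j)"
  proof (rule ccontr)
    assume "\<not> ?thesis"
    then have *: "card (EL j) < card (EL (Suc j))" for j by (meson not_le)
    have "Suc j \<le> card (EL j)" for j
    proof (induction j)
      case 0
      then show ?case using ELne[of 0] finEL[of 0] by (simp add: Suc_le_eq card_gt_0_iff)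
    next
      case (Suc j)
      then show ?case using *[of j] by linarith
    qed
    from this[of r] card_mono[OF finL ELL, of r] few show False by linarith
  qed
  then obtain j where j: "card (EL (Suc j)) \<le> card (EL j)" by blast
  have fim: "(\<lambda>u. u @ [nxt u]) ` EL j = EL (Suc j)"
  proof (rule card_seteq[OF finEL fEL])
    show "card (EL (Suc j)) \<le> card ((\<lambda>u. u @ [nxt u]) ` EL j)"
      using j by (simp add: card_image[OF finj])
  qed
  have det: "s = nxt u" if "u \<in> EL j" "u @ [s] \<in> E" for u s
  proof -
    have "u @ [s] \<in> EL (Suc j)" using that by (auto simp: EL_def)
    then show ?thesis unfolding fim[symmetric] by auto
  qed
  \<comment> \<open>the window of the last \<open>j\<close> letters, shifted by one letter\<close>
  define T where "T u = tl (u @ [nxt u])" for u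
  have T: "T u \<in> EL j" if "u \<in> EL j" for u
  proof -
    have "u @ [nxt u] \<in> E" using nxt that by (auto simp: EL_def)
    moreover have "u @ [nxt u] = [hd (u @ [nxt u])] @ T u"
      unfolding T_def by (simp add: hd_Cons_tl)
    ultimately have "T u \<in> E" using E_suffix by metis
    then show ?thesis using that by (auto simp: EL_def T_def)
  qed
  obtain u0 where u0: "u0 \<in> EL j" using ELne by blast
  have Tpow: "(T ^^ i) u \<in> EL j" if "u \<in> EL j" for i u
    using that by (induction i) (auto intro: T)
  have "range (\<lambda>i. (T ^^ i) u0) \<subseteq> EL j" using Tpow[OF u0] by blast
  then have "finite (range (\<lambda>i. (T ^^ i) u0))" using finEL finite_subset by blast
  then have "\<not> inj (\<lambda>i. (T ^^ i) u0)" using finite_imageD infinite_UNIV_nat by blast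
  then obtain a b where ab: "a < b" "(T ^^ a) u0 = (T ^^ b) u0"
    using linorder_injI[of "\<lambda>i. (T ^^ i) u0"] by blast
  define q where "q = b - a"
  define u1 where "u1 = (T ^^ a) u0"
  have u1: "u1 \<in> EL j" unfolding u1_def by (rule Tpow[OF u0])
  have "(T ^^ q) ((T ^^ a) u0) = (T ^^ (q + a)) u0" by (simp add: funpow_add)
  then have q: "q > 0" "(T ^^ q) u1 = u1"
    using ab unfolding q_def u1_def by simp_all
  define l where "l k = nxt ((T ^^ k) u1)" for k
  have lper: "l (k + q) = l k" for k
    unfolding l_def by (simp add: funpow_add q)
  \<comment> \<open>the \<open>k\<close> letters that the deterministic process writes after \<open>u1\<close>\<close>
  define W where "W k = map l [0..<k]" for k
  have W: "u1 @ W k \<in> E \<and> drop k (u1 @ W k) = (T ^^ k) u1" for k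
  proof (induction k)
    case 0
    then show ?case using u1 by (auto simp: W_def EL_def)
  next
    case (Suc k)
    obtain s where s: "(u1 @ W k) @ [s] \<in> E" using E_ext Suc by blast
    have "(u1 @ W k) @ [s] = take k (u1 @ W k) @ ((T ^^ k) u1 @ [s])"
      using Suc by (metis append.assoc append_take_drop_id)
    then have "(T ^^ k) u1 @ [s] \<in> E" using s E_suffix by metis
    then have sk: "s = l k" using det Tpow[OF u1] unfolding l_def by blast
    have "drop (Suc k) (u1 @ W k @ [l k]) = tl (drop k ((u1 @ W k) @ [l k]))"
      by (simp only: append.assoc drop_Suc tl_drop)
    also have "\<dots> = tl ((T ^^ k) u1 @ [l k])"
      using Suc by (subst drop_append) (simp add: W_def)
    also have "\<dots> = (T ^^ Suc k) u1" by (simp add: T_def l_def)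
    finally show ?case using s sk by (simp add: W_def)
  qed
  have WL: "W k \<in> L" for k using W E_suffix E_L by blast
  have Wrep: "W (m * q) = concat (replicate m (W q))" for m
  proof (induction m)
    case 0
    then show ?case by (simp add: W_def)
  next
    case (Suc m)
    have "W (Suc m * q) = map l ([0..<q] @ [q..<q + m * q])"
      unfolding W_def using upt_add_eq_append[of 0 q "m * q"] by simp
    also have "[q..<q + m * q] = map (\<lambda>k. k + q) [0..<m * q]"
      by (simp add: map_add_upt add.commute)
    also have "map l ([0..<q] @ map (\<lambda>k. k + q) [0..<m * q]) = W q @ W (m * q)"
      by (simp add: W_def lper o_def)
    finally show ?case using Suc by simp
  qed
  have "W q \<noteq> []" using q by (simp add: W_def)
  then show ?thesis using WL Wrep by metis
qed

section \<open>Growth of infinite finitely generated groups\<close>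

locale cayley_graph = group G for G (structure) +
  fixes S :: "'a set"
  assumes infinite_carrier: "infinite (carrier G)"
    and finite_S: "finite S"
    and S_carrier: "S \<subseteq> carrier G"
    and S_symmetric: "S = (\<lambda>s. inv s) ` S"
    and S_generates: "generate G S = carrier G"
begin

lemma S_closed [simp, intro]: "s \<in> S \<Longrightarrow> s \<in> carrier G"
  using S_carrier by blast

lemma inv_S [simp, intro]: "s \<in> S \<Longrightarrow> inv s \<in> S"
  using S_symmetric by blast

text \<open>
  The ball around the identity for the word metric. Since edges join \<open>u\<close> to \<open>s u\<close>, the
  vertices within distance \<open>k\<close> of \<open>x\<close> are the products \<open>h x\<close> with \<open>h\<close> in the ball of radius \<open>k\<close>.
\<close>

primrec word_ball :: "nat \<Rightarrow> 'a set" where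
  "word_ball 0 = {\<one>}"
| "word_ball (Suc k) = word_ball k \<union> (\<lambda>(s, x). s \<otimes> x) ` (S \<times> word_ball k)"

lemma word_ball_carrier: "word_ball k \<subseteq> carrier G"
  by (induction k) auto

lemma word_ball_closed [simp, intro]: "x \<in> word_ball k \<Longrightarrow> x \<in> carrier G"
  using word_ball_carrier by blast

lemma finite_word_ball [simp, intro]: "finite (word_ball k)"
  by (induction k) (auto simp: finite_S)

lemma word_ball_mono: "j \<le> k \<Longrightarrow> word_ball j \<subseteq> word_ball k"
  by (rule lift_Suc_mono_le[of word_ball]) auto

lemma one_word_ball [simp, intro]: "\<one> \<in> word_ball k"
  using word_ball_mono[of 0 k] by simp

lemma word_ball_Suc_mult: "s \<in> S \<Longrightarrow> x \<in> word_ball k \<Longrightarrow> s \<otimes> x \<in> word_ball (Suc k)"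
  by auto

lemma word_ball_mult: "x \<in> word_ball j \<Longrightarrow> y \<in> word_ball k \<Longrightarrow> x \<otimes> y \<in> word_ball (j + k)"
proof (induction j arbitrary: x)
  case 0
  then show ?case by auto
next
  case (Suc j)
  show ?case
  proof (cases "x \<in> word_ball j")
    case True
    then show ?thesis using Suc by auto
  next
    case False
    then obtain s w where "s \<in> S" "w \<in> word_ball j" "x = s \<otimes> w" using Suc.prems by auto
    then show ?thesis using Suc.IH[of w] Suc.prems word_ball_Suc_mult[of s "w \<otimes> y"]
      by (simp add: m_assoc word_ball_closed[OF \<open>y \<in> _\<close>] del: word_ball.simps)
  qed
qed

lemma word_ball_pow: "x \<in> word_ball j \<Longrightarrow> x [^] (i::nat) \<in> word_ball (i * j)"
proof (induction i)
  case (Suc i)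
  then show ?case using word_ball_mult[of "x [^] i" "i * j" x j] by (simp add: add.commute)
qed auto

lemma word_ball_exhausts:
  assumes "x \<in> carrier G" shows "\<exists>k. x \<in> word_ball k"
proof -
  have "x \<in> generate G S" using assms S_generates by simp
  then show ?thesis
  proof induction
    case one
    then show ?case by blast
  next
    case (incl h)
    then have "h \<otimes> \<one> \<in> word_ball (Suc 0)" by (intro word_ball_Suc_mult) auto
    then show ?case using incl by (metis S_closed r_one)
  next
    case (inv h)
    then have "inv h \<otimes> \<one> \<in> word_ball (Suc 0)" by (intro word_ball_Suc_mult) auto
    then show ?case using inv by (metis S_closed inv_closed r_one)
  next
    case (eng h1 h2)
    then show ?case using word_ball_mult by blast
  qed
qed

text \<open>
  Because the generating set is symmetric, closure under left multiplication by generators already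
  gives all of the group; in graph terms, the Cayley graph is connected.
\<close>

lemma S_invariant_eq_carrier:
  assumes "\<one> \<in> U" and "\<And>s u. s \<in> S \<Longrightarrow> u \<in> U \<Longrightarrow> s \<otimes> u \<in> U"
  shows "carrier G \<subseteq> U"
proof
  fix x assume "x \<in> carrier G"
  then obtain k where "x \<in> word_ball k" using word_ball_exhausts by blast
  moreover have "word_ball k \<subseteq> U" by (induction k) (use assms in auto)
  ultimately show "x \<in> U" by blast
qed

primrec word_value :: "(nat \<Rightarrow> 'a) \<Rightarrow> nat list \<Rightarrow> 'a" where
  "word_value \<sigma> [] = \<one>"
| "word_value \<sigma> (i # w) = \<sigma> i \<otimes> word_value \<sigma> w"

text \<open>
  Represent every element by its shortlex-minimal word. The set of these words is closed under
  factors, since replacing a factor by a smaller word of equal value would make the whole word smaller.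
  If at most \<open>r\<close> of them had length \<open>r\<close>, then all powers of some nonempty word \<open>v\<close> would be minimal.
  Minimal words have distinct values, so the value of \<open>v\<close> would have infinite order.
\<close>

lemma growth_of_torsion:
  assumes torsion: "\<And>z. z \<in> carrier G \<Longrightarrow> \<exists>m>0. z [^] (m::nat) = \<one>"
  shows "k\<^sup>2 \<le> 2 * card (word_ball k)"
proof -
  obtain \<sigma> :: "nat \<Rightarrow> 'a" and d where \<sigma>: "bij_betw \<sigma> {0..<d} S"
    using ex_bij_betw_nat_finite[OF finite_S] by blast
  define A where "A = {0..<d}"
  have \<sigma>S: "\<sigma> i \<in> S" if "i \<in> A" for i using \<sigma> that unfolding A_def bij_betw_def by blast
  have S\<sigma>: "\<exists>i\<in>A. \<sigma> i = s" if "s \<in> S" for s using \<sigma> that unfolding A_def bij_betw_def by auto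
  let ?v = "word_value \<sigma>"
  have v_ball: "?v w \<in> word_ball (length w)" if "w \<in> lists A" for w
    using that by (induction w) (auto intro: \<sigma>S)
  have v_closed [simp]: "?v w \<in> carrier G" if "w \<in> lists A" for w
    using v_ball[OF that] by blast
  have v_append: "?v (u @ w) = ?v u \<otimes> ?v w" if "u \<in> lists A" "w \<in> lists A" for u w
    using that(1) by (induction u) (use that(2) \<sigma>S in \<open>auto simp: m_assoc\<close>)
  have v_surj: "\<exists>w\<in>lists A. ?v w = x" if "x \<in> carrier G" for x
  proof -
    have "carrier G \<subseteq> ?v ` lists A"
    proof (rule S_invariant_eq_carrier)
      show "\<one> \<in> ?v ` lists A" by (rule image_eqI[of _ _ "[]"]) auto
    next
      fix s u assume "s \<in> S" "u \<in> ?v ` lists A"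
      then obtain i w where "i \<in> A" "\<sigma> i = s" "w \<in> lists A" "u = ?v w" using S\<sigma> by blast
      then show "s \<otimes> u \<in> ?v ` lists A" by (intro image_eqI[of _ _ "i # w"]) auto
    qed
    then show ?thesis using that by auto
  qed
  \<comment> \<open>the shortlex-minimal words\<close>
  define L where "L = {w \<in> lists A. \<forall>w'\<in>lists A. ?v w' = ?v w \<longrightarrow> (w', w) \<notin> lenlex less_than}"
  have inj: "inj_on ?v L"
  proof (rule inj_onI)
    fix u w assume *: "u \<in> L" "w \<in> L" "?v u = ?v w"
    have "total (lenlex less_than)" by (rule total_lenlex) (rule total_less_than)
    then have "u = w \<or> (u, w) \<in> lenlex less_than \<or> (w, u) \<in> lenlex less_than"
      by (auto simp: total_on_def)
    then show "u = w" using * unfolding L_def by auto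
  qed
  have surj: "carrier G \<subseteq> ?v ` L"
  proof
    fix x assume "x \<in> carrier G"
    then obtain w0 where w0: "w0 \<in> {w \<in> lists A. ?v w = x}" using v_surj by blast
    have wf: "wf (lenlex less_than)" by (rule wf_lenlex) (rule wf_less_than)
    obtain w where w: "w \<in> {w \<in> lists A. ?v w = x}"
      "\<And>y. (y, w) \<in> lenlex less_than \<Longrightarrow> y \<notin> {w \<in> lists A. ?v w = x}"
      using wfE_min[OF wf w0] by blast
    then have "w \<in> L" unfolding L_def by blast
    then show "x \<in> ?v ` L" using w(1) by blast
  qed
  have infL: "infinite L" using surj infinite_carrier finite_surj by blast
  have LA: "L \<subseteq> lists A" unfolding L_def by blast
  have factor: "v \<in> L" if "u @ v @ w \<in> L" for u v w
  proof -
    have uvw: "u \<in> lists A" "v \<in> lists A" "w \<in> lists A" using that LA by auto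
    have "(v', v) \<notin> lenlex less_than" if "v' \<in> lists A" "?v v' = ?v v" for v'
    proof
      assume "(v', v) \<in> lenlex less_than"
      then have "(u @ v' @ w, u @ v @ w) \<in> lenlex less_than"
        by (simp add: lenlex_append1 irrefl_def)
      moreover have "?v (u @ v' @ w) = ?v (u @ v @ w)" using that uvw by (simp add: v_append)
      moreover have "u @ v' @ w \<in> lists A" using that uvw by simp
      ultimately show False using \<open>u @ v @ w \<in> L\<close> unfolding L_def by blast
    qed
    then show ?thesis using uvw unfolding L_def by blast
  qed
  define LL where "LL r = {w \<in> L. length w = r}" for r
  have many: "Suc r \<le> card (LL r)" for r
  proof (rule ccontr)
    assume "\<not> ?thesis"
    then have "card {w \<in> L. length w = r} \<le> r" by (simp add: LL_def)
    then obtain v where v: "v \<noteq> []" "\<And>m. concat (replicate m v) \<in> L"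
      using periodic_words[of A L r] LA infL factor by (auto simp: A_def)
    have vA: "v \<in> lists A" using v(2)[of 1] LA by auto
    have pow: "?v (concat (replicate m v)) = ?v v [^] m" for m
    proof (induction m)
      case (Suc m)
      have "concat (replicate m v) \<in> lists A" using v(2) LA by blast
      then show ?case using Suc vA nat_pow_Suc2[of "?v v" m] by (simp add: v_append)
    qed simp
    obtain m :: nat where "m > 0" "?v v [^] m = \<one>" using torsion[OF v_closed[OF vA]] by blast
    then have "?v (concat (replicate m v)) = ?v (concat (replicate 0 v))" using pow by simp
    then have "concat (replicate m v) = concat (replicate 0 v)"
      using inj v(2) by (meson inj_onD)
    then show False using v(1) \<open>m > 0\<close> by simp
  qed
  have finLL: "finite (LL r)" for r
    by (rule finite_subset[OF _ finite_lists_length_le[of A r]]) (use LA in \<open>auto simp: LL_def A_def\<close>)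
  have "(\<Sum>r\<le>k. Suc r) \<le> (\<Sum>r\<le>k. card (LL r))" by (intro sum_mono many)
  also have "\<dots> = card (\<Union>r\<le>k. LL r)"
    by (rule card_UN_disjoint[symmetric]) (use finLL in \<open>auto simp: LL_def\<close>)
  also have "\<dots> = card (?v ` (\<Union>r\<le>k. LL r))"
    by (rule card_image[symmetric], rule inj_on_subset[OF inj]) (auto simp: LL_def)
  also have "\<dots> \<le> card (word_ball k)"
  proof (rule card_mono)
    show "?v ` (\<Union>r\<le>k. LL r) \<subseteq> word_ball k"
      using v_ball LA word_ball_mono by (fastforce simp: LL_def)
  qed simp
  finally have "(\<Sum>r\<le>k. Suc r) \<le> card (word_ball k)" .
  moreover have "k\<^sup>2 \<le> 2 * (\<Sum>r\<le>k. Suc r)"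
    by (induction k) (auto simp: power2_eq_square)
  ultimately show ?thesis by linarith
qed

lemma inj_pow_of_infinite_order:
  assumes z: "z \<in> carrier G" and ord: "\<And>m. m > 0 \<Longrightarrow> z [^] (m::nat) \<noteq> \<one>"
  shows "inj (\<lambda>j::nat. z [^] j)"
proof (rule linorder_injI)
  fix i j :: nat assume ij: "i < j"
  have "z [^] j = z [^] i \<otimes> z [^] (j - i)" using nat_pow_mult[OF z, of i "j - i"] ij by simp
  moreover have "z [^] i \<otimes> z [^] (j - i) \<noteq> z [^] i \<otimes> \<one>"
    using ord[of "j - i"] ij z by (simp del: r_one)
  ultimately show "z [^] i \<noteq> z [^] j" using z by simp
qed

text \<open>
  Count left cosets of the cyclic subgroup generated by \<open>z\<close>. If a ball of radius \<open>k\<close> meets the same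
  cosets as the next ball, then the union of these cosets is invariant under the generators, hence the
  whole group; as \<open>x z\<^sup>i\<close> conjugates \<open>z\<close> to the same element as \<open>x\<close>, the conjugates of \<open>z\<close> are then
  those by elements of the ball. Otherwise the ball of radius \<open>k\<close> meets more than \<open>k\<close> cosets, and
  multiplying representatives by \<open>z\<^sup>0, \<dots>, z\<^sup>k\<close> gives more than \<open>k\<^sup>2\<close> elements in a ball of radius
  \<open>O(k)\<close>.
\<close>

lemma growth_of_infinite_order:
  assumes z: "z \<in> carrier G" and ord: "\<And>m. m > 0 \<Longrightarrow> z [^] (m::nat) \<noteq> \<one>"
    and inf: "infinite ((\<lambda>x. x \<otimes> z \<otimes> inv x) ` carrier G)"
  shows "\<exists>c>0. \<forall>k. c * (real k)\<^sup>2 \<le> real (card (word_ball k))"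
proof -
  define C where "C x = {x \<otimes> z [^] i | i. i \<in> (UNIV :: int set)}" for x
  have C_self: "x \<in> C x" if "x \<in> carrier G" for x
    unfolding C_def using that by (auto intro!: exI[of _ "0::int"])
  have C_sub: "C y \<subseteq> C x" if x: "x \<in> carrier G" and y: "y \<in> C x" for x y
  proof
    fix w assume "w \<in> C y"
    then obtain i j :: int where "y = x \<otimes> z [^] i" "w = y \<otimes> z [^] j"
      using y unfolding C_def by auto
    then have "w = x \<otimes> z [^] (i + j)" using x z by (simp add: m_assoc int_pow_mult)
    then show "w \<in> C x" unfolding C_def by blast
  qed
  have C_sym: "x \<in> C y" if x: "x \<in> carrier G" and y: "y \<in> C x" for x y
  proof -
    obtain i :: int where i: "y = x \<otimes> z [^] i" using y unfolding C_def by auto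
    then have "x = y \<otimes> z [^] (- i)" using x z
      by (simp add: m_assoc int_pow_mult[symmetric])
    then show ?thesis unfolding C_def by blast
  qed
  have C_carrier: "C x \<subseteq> carrier G" if "x \<in> carrier G" for x
    unfolding C_def using that z by auto
  have C_eq: "C y = C x" if "x \<in> carrier G" "y \<in> C x" for x y
    using C_sub[of x y] C_sub[of y x] C_sym[of x y] C_carrier that by blast
  have NC: "card (C ` word_ball k) < card (C ` word_ball (Suc k))" for k
  proof -
    have "C ` word_ball k \<noteq> C ` word_ball (Suc k)"
    proof
      assume eq: "C ` word_ball k = C ` word_ball (Suc k)"
      have "carrier G \<subseteq> \<Union> (C ` word_ball k)"
      proof (rule S_invariant_eq_carrier)
        show "\<one> \<in> \<Union> (C ` word_ball k)" using C_self[of \<one>] by blast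
      next
        fix s u assume s: "s \<in> S" and "u \<in> \<Union> (C ` word_ball k)"
        then obtain x and i :: int where x: "x \<in> word_ball k" "u = x \<otimes> z [^] i"
          unfolding C_def by blast
        then have "s \<otimes> u = (s \<otimes> x) \<otimes> z [^] i" using s z word_ball_closed[OF x(1)] by (simp add: m_assoc)
        then have "s \<otimes> u \<in> C (s \<otimes> x)" unfolding C_def by blast
        moreover have "C (s \<otimes> x) \<in> C ` word_ball k"
          unfolding eq using word_ball_Suc_mult[OF s x(1)] by blast
        ultimately show "s \<otimes> u \<in> \<Union> (C ` word_ball k)" by blast
      qed
      then have "(\<lambda>x. x \<otimes> z \<otimes> inv x) ` carrier G \<subseteq> (\<lambda>x. x \<otimes> z \<otimes> inv x) ` word_ball k"
      proof (intro image_subsetI)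
        fix y assume sub: "carrier G \<subseteq> \<Union> (C ` word_ball k)" and "y \<in> carrier G"
        then obtain x and i :: int where x: "x \<in> word_ball k" "y = x \<otimes> z [^] i"
          unfolding C_def by blast
        have xc: "x \<in> carrier G" using x by blast
        have "z [^] i \<otimes> z = z \<otimes> z [^] i"
          using int_pow_mult[OF z, of i 1] int_pow_mult[OF z, of 1 i] z by (simp add: add.commute)
        then have "y \<otimes> z \<otimes> inv y = (x \<otimes> z) \<otimes> (z [^] i \<otimes> inv (z [^] i)) \<otimes> inv x"
          using x(2) xc z by (simp add: m_assoc inv_mult_group) (simp add: m_assoc[symmetric])
        then have "y \<otimes> z \<otimes> inv y = x \<otimes> z \<otimes> inv x" using xc z by simp
        then show "y \<otimes> z \<otimes> inv y \<in> (\<lambda>x. x \<otimes> z \<otimes> inv x) ` word_ball k" using x(1) by blast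
      qed
      then show False using inf finite_subset by blast
    qed
    moreover have "C ` word_ball k \<subseteq> C ` word_ball (Suc k)" using word_ball_mono[of k "Suc k"] by auto
    ultimately show ?thesis by (intro psubset_card_mono) (auto simp del: word_ball.simps)
  qed
  have NC': "Suc k \<le> card (C ` word_ball k)" for k
  proof (induction k)
    case 0
    then show ?case by simp
  next
    case (Suc k)
    then show ?case using NC[of k] by linarith
  qed
  obtain l where l: "z \<in> word_ball l" using word_ball_exhausts z by blast
  have zinj: "i = j" if "z [^] (i::nat) = z [^] (j::nat)" for i j
    using inj_pow_of_infinite_order[OF z ord] that by (meson injD)
  \<comment> \<open>one representative in the ball for each coset it meets, times the powers \<open>z\<^sup>0, \<dots>, z\<^sup>k\<close>\<close>
  have big: "(Suc k)\<^sup>2 \<le> card (word_ball (k + k * l))" for k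
  proof -
    obtain T where T: "T \<subseteq> word_ball k" "inj_on C T" "C ` word_ball k = C ` T"
      by (metis subset_image_inj order_refl)
    have finT: "finite T" using T(1) finite_subset by blast
    have cT: "Suc k \<le> card T" using NC'[of k] T(2,3) by (simp add: card_image)
    have inj: "inj_on (\<lambda>(x, i::nat). x \<otimes> z [^] i) (T \<times> {0..k})"
    proof (rule inj_onI, clarify)
      fix x i y j assume h: "x \<in> T" "y \<in> T" "x \<otimes> z [^] (i::nat) = y \<otimes> z [^] (j::nat)"
      have xy: "x \<in> carrier G" "y \<in> carrier G" using h T(1) by auto
      have in_C: "w \<otimes> z [^] n \<in> C w" for w and n :: nat
        unfolding C_def by (auto simp: int_pow_int intro!: exI[of _ "int n"])
      have "C x = C y" using C_eq[OF xy(1) in_C, of i] C_eq[OF xy(2) in_C, of j] h(3) by simp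
      then have "x = y" using T(2) h by (meson inj_onD)
      then show "x = y \<and> i = j" using h xy z zinj by simp
    qed
    have "Suc k * Suc k \<le> card (T \<times> {0..k})" using mult_le_mono1[OF cT, of "Suc k"]
      by (simp add: card_cartesian_product del: mult_Suc mult_Suc_right)
    also have "\<dots> = card ((\<lambda>(x, i::nat). x \<otimes> z [^] i) ` (T \<times> {0..k}))"
      using card_image[OF inj] by simp
    also have "\<dots> \<le> card (word_ball (k + k * l))"
    proof (rule card_mono, simp, clarify)
      fix x i assume "x \<in> T" "i \<in> {0..k}"
      then have "x \<otimes> z [^] i \<in> word_ball (k + i * l)"
        using T(1) word_ball_mult word_ball_pow[OF l] by blast
      moreover have "k + i * l \<le> k + k * l" using \<open>i \<in> _\<close> by simp
      ultimately show "x \<otimes> z [^] i \<in> word_ball (k + k * l)" using word_ball_mono by blast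
    qed
    finally show ?thesis by (simp add: power2_eq_square)
  qed
  have "1 / (real (Suc l))\<^sup>2 * (real n)\<^sup>2 \<le> real (card (word_ball n))" for n
  proof -
    define k where "k = n div Suc l"
    have "k + k * l \<le> n" unfolding k_def using div_times_less_eq_dividend[of n "Suc l"] by simp
    then have "card (word_ball (k + k * l)) \<le> card (word_ball n)"
      by (intro card_mono word_ball_mono) auto
    then have 1: "(Suc k)\<^sup>2 \<le> card (word_ball n)" using big[of k] by linarith
    have "n \<le> Suc l * Suc k" unfolding k_def
      by (metis dividend_less_times_div less_imp_le zero_less_Suc mult_Suc_right)
    then have "real n \<le> real (Suc l) * real (Suc k)" by (metis of_nat_le_iff of_nat_mult)
    then have "(real n / real (Suc l))\<^sup>2 \<le> (real (Suc k))\<^sup>2"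
      by (intro power_mono) (auto simp: field_simps)
    also have "\<dots> \<le> real (card (word_ball n))" using 1 by (metis of_nat_le_iff of_nat_power)
    finally show ?thesis by (simp add: power_divide)
  qed
  then show ?thesis by (intro exI[of _ "1 / (real (Suc l))\<^sup>2"]) auto
qed

text \<open>
  The second alternative covers the groups of linear growth. The quadratic bound for all radii, rather
  than for some sequence of radii, is what makes the error terms below uniform.
\<close>

theorem growth_dichotomy:
  "(\<exists>c>0. \<forall>k. c * (real k)\<^sup>2 \<le> real (card (word_ball k))) \<or>
   (\<exists>z\<in>carrier G. (\<forall>m>0. z [^] (m::nat) \<noteq> \<one>) \<and> finite ((\<lambda>x. x \<otimes> z \<otimes> inv x) ` carrier G))"
proof (cases "\<exists>z\<in>carrier G. \<forall>m>0. z [^] (m::nat) \<noteq> \<one>")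
  case True
  then show ?thesis using growth_of_infinite_order by blast
next
  case False
  then have "k\<^sup>2 \<le> 2 * card (word_ball k)" for k by (intro growth_of_torsion) blast
  then have "1 / 2 * (real k)\<^sup>2 \<le> real (card (word_ball k))" for k
  proof -
    have "real (k\<^sup>2) \<le> real (2 * card (word_ball k))" using \<open>\<And>k. k\<^sup>2 \<le> _\<close> of_nat_le_iff by blast
    then show ?thesis by simp
  qed
  then show ?thesis by (intro disjI1 exI[of _ "1/2"]) auto
qed

end

section \<open>Translates that nearly touch\<close>

context cayley_graph
begin

lemma finite_subset_word_ball:
  assumes "finite X" "X \<subseteq> carrier G" shows "\<exists>k. X \<subseteq> word_ball k"
  using assms
proof (induction X)
  case (insert x X)
  then obtain j k where "X \<subseteq> word_ball j" "x \<in> word_ball k" using word_ball_exhausts[of x] by auto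
  then have "insert x X \<subseteq> word_ball (max j k)"
    using word_ball_mono[of j "max j k"] word_ball_mono[of k "max j k"] by auto
  then show ?case by blast
qed auto

lemma meeting_translates_eq:
  assumes "A \<subseteq> carrier G" "B \<subseteq> carrier G"
  shows "{g \<in> carrier G. A \<inter> (\<lambda>x. x \<otimes> g) ` B \<noteq> {}} = (\<lambda>(b, a). inv b \<otimes> a) ` (B \<times> A)"
proof (intro equalityI subsetI)
  fix g assume "g \<in> {g \<in> carrier G. A \<inter> (\<lambda>x. x \<otimes> g) ` B \<noteq> {}}"
  then obtain b where b: "g \<in> carrier G" "b \<in> B" "b \<otimes> g \<in> A" by blast
  moreover have "b \<in> carrier G" using b assms by blast
  ultimately have "g = inv b \<otimes> (b \<otimes> g)" by (simp add: m_assoc[symmetric])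
  then show "g \<in> (\<lambda>(b, a). inv b \<otimes> a) ` (B \<times> A)" using b by force
next
  fix g assume "g \<in> (\<lambda>(b, a). inv b \<otimes> a) ` (B \<times> A)"
  then obtain a b where ab: "a \<in> A" "b \<in> B" "g = inv b \<otimes> a" by auto
  moreover have "a \<in> carrier G" "b \<in> carrier G" using ab assms by auto
  ultimately have "b \<otimes> g = a" by (simp add: m_assoc[symmetric])
  then have "a \<in> A \<inter> (\<lambda>x. x \<otimes> g) ` B" using ab(1,2) by force
  moreover have "g \<in> carrier G" using ab \<open>a \<in> carrier G\<close> \<open>b \<in> carrier G\<close> by simp
  ultimately show "g \<in> {g \<in> carrier G. A \<inter> (\<lambda>x. x \<otimes> g) ` B \<noteq> {}}" by blast
qed

text \<open>
  Move \<open>B\<close> by successive powers of \<open>z\<close>. Since \<open>z\<close> has infinite order and the sets are finite, there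
  is a last power \<open>z\<^sup>j\<close> for which \<open>B z\<^sup>j\<close> still meets \<open>A\<close>, say in \<open>b z\<^sup>j\<close>. The next translate is
  disjoint from \<open>A\<close> and contains \<open>b z\<^sup>j\<^sup>+\<^sup>1 = (b z b\<^sup>-\<^sup>1) (b z\<^sup>j)\<close>.
\<close>

lemma disjoint_translate_by_conjugates:
  assumes z: "z \<in> carrier G" and ord: "\<And>m. m > 0 \<Longrightarrow> z [^] (m::nat) \<noteq> \<one>"
    and conj: "\<And>x. x \<in> carrier G \<Longrightarrow> x \<otimes> z \<otimes> inv x \<in> word_ball \<kappa>"
    and A: "A \<subseteq> carrier G" "finite A" "\<one> \<in> A"
    and B: "B \<subseteq> carrier G" "finite B" "\<one> \<in> B"
  shows "\<exists>g\<in>carrier G. A \<inter> (\<lambda>x. x \<otimes> g) ` B = {} \<and>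
           (\<exists>a\<in>A. \<exists>b\<in>B. \<exists>h\<in>word_ball \<kappa>. b \<otimes> g = h \<otimes> a)"
proof -
  define J where "J = {j::nat. A \<inter> (\<lambda>x. x \<otimes> z [^] j) ` B \<noteq> {}}"
  have inj: "inj (\<lambda>j::nat. z [^] j)" by (rule inj_pow_of_infinite_order[OF z ord])
  have "J \<subseteq> (\<lambda>j::nat. z [^] j) -` ((\<lambda>(b, a). inv b \<otimes> a) ` (B \<times> A))"
    unfolding meeting_translates_eq[OF A(1) B(1), symmetric] J_def using z by auto
  then have finJ: "finite J"
    using finite_vimageI[OF _ inj] A B by (meson finite_SigmaI finite_imageI finite_subset)
  have "\<one> \<otimes> z [^] (0::nat) \<in> (\<lambda>x. x \<otimes> z [^] (0::nat)) ` B" using B by blast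
  then have "0 \<in> J" unfolding J_def using A by auto
  define j where "j = Max J"
  have j: "j \<in> J" "Suc j \<notin> J"
    using Max_in[OF finJ] \<open>0 \<in> J\<close> Max_ge[OF finJ, of "Suc j"] unfolding j_def by auto
  obtain b where b: "b \<in> B" "b \<otimes> z [^] j \<in> A" using j(1) unfolding J_def by auto
  have bc: "b \<in> carrier G" using b B by blast
  have "b \<otimes> z [^] Suc j = (b \<otimes> z \<otimes> inv b) \<otimes> (b \<otimes> z [^] j)"
  proof -
    have "(b \<otimes> z \<otimes> inv b) \<otimes> (b \<otimes> z [^] j) = b \<otimes> z \<otimes> (inv b \<otimes> b) \<otimes> z [^] j"
      using bc z by (simp add: m_assoc del: l_inv Units_l_inv)
    also have "\<dots> = b \<otimes> (z \<otimes> z [^] j)" using bc z by (simp add: m_assoc)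
    also have "z \<otimes> z [^] j = z [^] Suc j" using nat_pow_Suc2[OF z, of j] by simp
    finally show ?thesis by simp
  qed
  moreover have "A \<inter> (\<lambda>x. x \<otimes> z [^] Suc j) ` B = {}" using j(2) unfolding J_def by blast
  ultimately show ?thesis using b conj[OF bc] z nat_pow_closed by blast
qed

text \<open>
  Let \<open>X\<close> be the set of \<open>g\<close> for which \<open>B g\<close> meets \<open>A\<close>. If \<open>X\<close> is large, double counting the pairs
  \<open>(g, a)\<close> with \<open>a \<in> A \<inter> B g\<close>, of which there are \<open>|A| |B|\<close>, gives an element of \<open>X\<close> with small overlap.
  If \<open>X\<close> is small, consider the sets \<open>Y k\<close> of those \<open>g\<close> for which \<open>B g\<close> comes within distance \<open>k\<close> of
  \<open>A\<close>. They contain the balls of radius \<open>k\<close>, so they leave \<open>X\<close> at some first radius \<open>k\<close>, and the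
  quadratic growth bounds this radius by the cardinality of \<open>X\<close>.
\<close>

lemma sparse_translate_by_growth:
  assumes c: "c > 0" "\<And>k. c * (real k)\<^sup>2 \<le> real (card (word_ball k))"
    and A: "A \<subseteq> carrier G" "finite A" "\<one> \<in> A" "card A \<le> n"
    and B: "B \<subseteq> carrier G" "finite B" "\<one> \<in> B" "card B \<le> n"
  shows "\<exists>g\<in>carrier G. \<exists>k. real (card (A \<inter> (\<lambda>x. x \<otimes> g) ` B)) \<le> real n powr (2/3) \<and>
           real k \<le> 1 + real n powr (2/3) / sqrt c \<and>
           (\<exists>a\<in>A. \<exists>b\<in>B. \<exists>h\<in>word_ball k. b \<otimes> g = h \<otimes> a)"
proof -
  define X where "X = {g \<in> carrier G. A \<inter> (\<lambda>x. x \<otimes> g) ` B \<noteq> {}}"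
  have finX: "finite X" unfolding X_def meeting_translates_eq[OF A(1) B(1)] using A B by simp
  have "card A > 0" using A by (auto simp: card_gt_0_iff)
  then have n: "n > 0" using A by linarith
  show ?thesis
  proof (cases "real n powr (4/3) \<le> real (card X)")
    case True
    have "\<exists>g\<in>X. real (card (A \<inter> (\<lambda>x. x \<otimes> g) ` B)) \<le> real n powr (2/3)"
    proof (rule ccontr)
      assume "\<not> ?thesis"
      then have gt: "real n powr (2/3) < real (card (A \<inter> (\<lambda>x. x \<otimes> g) ` B))" if "g \<in> X" for g
        using that by force
      have "X \<noteq> {}" using True n by auto
      have inj: "inj_on (\<lambda>(g, a). (a, a \<otimes> inv g)) (SIGMA g:X. A \<inter> (\<lambda>x. x \<otimes> g) ` B)"
      proof (rule inj_onI)
        fix u v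
        assume h: "u \<in> (SIGMA g:X. A \<inter> (\<lambda>x. x \<otimes> g) ` B)" "v \<in> (SIGMA g:X. A \<inter> (\<lambda>x. x \<otimes> g) ` B)"
          "(case u of (g, a) \<Rightarrow> (a, a \<otimes> inv g)) = (case v of (g, a) \<Rightarrow> (a, a \<otimes> inv g))"
        obtain g a g' a' where uv: "u = (g, a)" "v = (g', a')" by (cases u, cases v)
        have c: "g \<in> carrier G" "g' \<in> carrier G" "a \<in> carrier G" "a = a'" "a \<otimes> inv g = a \<otimes> inv g'"
          using h A uv X_def by auto
        then have "inv g = inv g'" by simp
        then have "inv (inv g) = inv (inv g')" by simp
        then show "u = v" using c uv by simp
      qed
      have "(\<lambda>(g, a). (a, a \<otimes> inv g)) ` (SIGMA g:X. A \<inter> (\<lambda>x. x \<otimes> g) ` B) \<subseteq> A \<times> B"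
        using B by (auto simp: X_def subset_iff m_assoc)
      then have "card (SIGMA g:X. A \<inter> (\<lambda>x. x \<otimes> g) ` B) \<le> card (A \<times> B)"
        using A(2) B(2) by (intro card_inj_on_le[OF inj] finite_cartesian_product)
      also have "\<dots> \<le> n * n" using A B by (simp add: card_cartesian_product mult_mono)
      finally have "(\<Sum>g\<in>X. card (A \<inter> (\<lambda>x. x \<otimes> g) ` B)) \<le> n * n"
        using finX A by simp
      then have "(\<Sum>g\<in>X. real (card (A \<inter> (\<lambda>x. x \<otimes> g) ` B))) \<le> real n * real n"
        by (simp flip: of_nat_mult of_nat_sum)
      moreover have "(\<Sum>g\<in>X. real n powr (2/3)) < (\<Sum>g\<in>X. real (card (A \<inter> (\<lambda>x. x \<otimes> g) ` B)))"
        using finX \<open>X \<noteq> {}\<close> gt by (rule sum_strict_mono)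
      moreover have "real n * real n = real n powr (4/3) * real n powr (2/3)"
        using n by (simp add: powr_add[symmetric] powr_numeral power2_eq_square)
      moreover have "\<dots> \<le> real (card X) * real n powr (2/3)" using True by (intro mult_right_mono) auto
      ultimately show False by simp
    qed
    then obtain g where g: "g \<in> X" "real (card (A \<inter> (\<lambda>x. x \<otimes> g) ` B)) \<le> real n powr (2/3)" by blast
    then obtain b where b: "b \<in> B" "b \<otimes> g \<in> A" unfolding X_def by blast
    have "b \<otimes> g = \<one> \<otimes> (b \<otimes> g)" using b A by auto
    then have "\<exists>a\<in>A. \<exists>b\<in>B. \<exists>h\<in>word_ball 0. b \<otimes> g = h \<otimes> a" using b one_word_ball by blast
    moreover have "real 0 \<le> 1 + real n powr (2/3) / sqrt c" using c by simp
    ultimately show ?thesis using g unfolding X_def by blast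
  next
    case False
    define Y where "Y k = {g \<in> carrier G. \<exists>a\<in>A. \<exists>b\<in>B. \<exists>h\<in>word_ball k. b \<otimes> g = h \<otimes> a}" for k
    have ball_Y: "word_ball k \<subseteq> Y k" for k
    proof
      fix g assume g: "g \<in> word_ball k"
      then have "\<one> \<otimes> g = g \<otimes> \<one>" by auto
      then show "g \<in> Y k" unfolding Y_def using g A B by blast
    qed
    have "\<not> carrier G \<subseteq> X" using finX infinite_carrier finite_subset by blast
    then have ex: "\<exists>k. \<not> Y k \<subseteq> X" using word_ball_exhausts ball_Y by blast
    define k where "k = (LEAST k. \<not> Y k \<subseteq> X)"
    have k: "\<not> Y k \<subseteq> X" unfolding k_def using ex by (rule LeastI_ex)
    have "Y 0 \<subseteq> X"
    proof
      fix g assume "g \<in> Y 0"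
      then obtain a b where ab: "g \<in> carrier G" "a \<in> A" "b \<in> B" "b \<otimes> g = \<one> \<otimes> a"
        unfolding Y_def by auto
      then have "b \<otimes> g \<in> A" using A(1) by auto
      then show "g \<in> X" unfolding X_def using ab by blast
    qed
    then have "k \<noteq> 0" using k by auto
    then have "k - 1 < (LEAST k. \<not> Y k \<subseteq> X)" unfolding k_def by simp
    then have "Y (k - 1) \<subseteq> X" using not_less_Least[of "k - 1" "\<lambda>k. \<not> Y k \<subseteq> X"] by blast
    then have "card (word_ball (k - 1)) \<le> card X" using ball_Y finX by (meson card_mono order_trans)
    then have "c * (real (k - 1))\<^sup>2 \<le> real n powr (4/3)" using c(2)[of "k - 1"] False by linarith
    then have "(real (k - 1))\<^sup>2 \<le> real n powr (4/3) / c" using c by (simp add: field_simps)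
    also have "\<dots> = (real n powr (2/3) / sqrt c)\<^sup>2"
      using c n by (simp add: power_divide powr_power)
    finally have "real (k - 1) \<le> real n powr (2/3) / sqrt c" by (rule power2_le_imp_le) (use c in simp)
    moreover obtain g where g: "g \<in> Y k" "g \<notin> X" using k by blast
    moreover have "A \<inter> (\<lambda>x. x \<otimes> g) ` B = {}" using g unfolding X_def Y_def by blast
    ultimately show ?thesis using \<open>k \<noteq> 0\<close> unfolding Y_def
      by (intro bexI[of _ g] exI[of _ k]) auto
  qed
qed

text \<open>
  The substitute for pushing \<open>B\<close> out of \<open>A\<close>. In the case of quadratic growth, overlap and distance trade off
  against each other, and both are \<open>O(n powr (2/3))\<close>; in the case of finitely many conjugates, the sets are
  disjoint at bounded distance, which is stronger.
\<close>

theorem nearly_touching_translate: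
  "\<exists>C\<ge>1. \<forall>n A B. A \<subseteq> carrier G \<and> finite A \<and> \<one> \<in> A \<and> card A \<le> n \<and>
      B \<subseteq> carrier G \<and> finite B \<and> \<one> \<in> B \<and> card B \<le> n \<longrightarrow>
      (\<exists>g\<in>carrier G. \<exists>k. real (card (A \<inter> (\<lambda>x. x \<otimes> g) ` B)) \<le> C * real n powr (2/3) \<and>
           real k \<le> C * real n powr (2/3) \<and>
           (\<exists>a\<in>A. \<exists>b\<in>B. \<exists>h\<in>word_ball k. b \<otimes> g = h \<otimes> a))"
  using growth_dichotomy
proof (elim disjE exE conjE bexE)
  fix c :: real assume c: "c > 0" "\<forall>k. c * (real k)\<^sup>2 \<le> real (card (word_ball k))"
  define C where "C = 1 + 1 / sqrt c"
  have C: "C \<ge> 1" using c unfolding C_def by simp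
  have bnd: "x \<le> C * real n powr (2/3)" "y \<le> C * real n powr (2/3)"
    if "x \<le> real n powr (2/3)" "y \<le> 1 + real n powr (2/3) / sqrt c" "n \<ge> 1" for x y and n :: nat
  proof -
    have "1 \<le> real n powr (2/3)" using that(3) by (simp add: ge_one_powr_ge_zero)
    moreover from this have "1 * real n powr (2/3) \<le> C * real n powr (2/3)" using C by (intro mult_right_mono) auto
    moreover have "C * real n powr (2/3) = real n powr (2/3) + real n powr (2/3) / sqrt c"
      unfolding C_def by (simp add: field_simps)
    ultimately show "x \<le> C * real n powr (2/3)" "y \<le> C * real n powr (2/3)" using that by linarith+
  qed
  show ?thesis
  proof (intro exI[of _ C] conjI allI impI C)
    fix n A B
    assume *: "A \<subseteq> carrier G \<and> finite A \<and> \<one> \<in> A \<and> card A \<le> n \<and>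
      B \<subseteq> carrier G \<and> finite B \<and> \<one> \<in> B \<and> card B \<le> n"
    then have "card A > 0" by (auto simp: card_gt_0_iff)
    then have n: "n \<ge> 1" using * by linarith
    obtain g k where gk: "g \<in> carrier G" "real (card (A \<inter> (\<lambda>x. x \<otimes> g) ` B)) \<le> real n powr (2/3)"
      "real k \<le> 1 + real n powr (2/3) / sqrt c" "\<exists>a\<in>A. \<exists>b\<in>B. \<exists>h\<in>word_ball k. b \<otimes> g = h \<otimes> a"
      using sparse_translate_by_growth[of c A n B] c * by blast
    then show "\<exists>g\<in>carrier G. \<exists>k. real (card (A \<inter> (\<lambda>x. x \<otimes> g) ` B)) \<le> C * real n powr (2/3) \<and>
           real k \<le> C * real n powr (2/3) \<and>
           (\<exists>a\<in>A. \<exists>b\<in>B. \<exists>h\<in>word_ball k. b \<otimes> g = h \<otimes> a)"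
      using bnd[OF gk(2,3) n] by blast
  qed
next
  fix z assume z: "z \<in> carrier G" "\<forall>m>0. z [^] (m::nat) \<noteq> \<one>"
    "finite ((\<lambda>x. x \<otimes> z \<otimes> inv x) ` carrier G)"
  obtain \<kappa> where \<kappa>: "(\<lambda>x. x \<otimes> z \<otimes> inv x) ` carrier G \<subseteq> word_ball \<kappa>"
    using finite_subset_word_ball[OF z(3)] z(1) by blast
  define C where "C = 1 + real \<kappa>"
  have bnd: "real \<kappa> \<le> C * real n powr (2/3)" if "n \<ge> 1" for n :: nat
  proof -
    have "1 \<le> real n powr (2/3)" using that by (simp add: ge_one_powr_ge_zero)
    then have "C * 1 \<le> C * real n powr (2/3)" unfolding C_def by (intro mult_left_mono) auto
    then show ?thesis unfolding C_def mult_1_right by linarith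
  qed
  show ?thesis
  proof (intro exI[of _ C] conjI allI impI)
    show "1 \<le> C" unfolding C_def by simp
  next
    fix n A B
    assume *: "A \<subseteq> carrier G \<and> finite A \<and> \<one> \<in> A \<and> card A \<le> n \<and>
      B \<subseteq> carrier G \<and> finite B \<and> \<one> \<in> B \<and> card B \<le> n"
    then have "card A > 0" by (auto simp: card_gt_0_iff)
    then have n: "n \<ge> 1" using * by linarith
    obtain g where g: "g \<in> carrier G" "A \<inter> (\<lambda>x. x \<otimes> g) ` B = {}"
      "\<exists>a\<in>A. \<exists>b\<in>B. \<exists>h\<in>word_ball \<kappa>. b \<otimes> g = h \<otimes> a"
      using disjoint_translate_by_conjugates[of z \<kappa> A B] z \<kappa> * by blast
    moreover have "real (card (A \<inter> (\<lambda>x. x \<otimes> g) ` B)) \<le> C * real n powr (2/3)"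
      unfolding g(2) C_def by simp
    ultimately show "\<exists>g\<in>carrier G. \<exists>k. real (card (A \<inter> (\<lambda>x. x \<otimes> g) ` B)) \<le> C * real n powr (2/3) \<and>
           real k \<le> C * real n powr (2/3) \<and>
           (\<exists>a\<in>A. \<exists>b\<in>B. \<exists>h\<in>word_ball k. b \<otimes> g = h \<otimes> a)"
      using bnd[OF n] by blast
  qed
qed

end

section \<open>Connected components of graphs\<close>

lemma component_root: "x \<in> V \<Longrightarrow> x \<in> graph_component V F x"
  by (simp add: graph_component_def)

lemma component_subset: "graph_component V F x \<subseteq> V"
  by (auto simp: graph_component_def)

lemma component_step:
  "u \<in> graph_component V F x \<Longrightarrow> v \<in> V \<Longrightarrow> {u, v} \<in> F \<Longrightarrow> v \<in> graph_component V F x"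
  by (auto simp: graph_component_def intro: rtrancl.rtrancl_into_rtrancl)

lemma component_least:
  assumes "x \<in> U" and "\<And>u v. u \<in> U \<Longrightarrow> u \<in> V \<Longrightarrow> v \<in> V \<Longrightarrow> {u, v} \<in> F \<Longrightarrow> v \<in> U"
  shows "graph_component V F x \<subseteq> U"
proof
  fix y assume "y \<in> graph_component V F x"
  then have "(x, y) \<in> {(u, v). u \<in> V \<and> v \<in> V \<and> {u, v} \<in> F}\<^sup>*"
    by (simp add: graph_component_def)
  then show "y \<in> U" by induction (use assms in auto)
qed

lemma component_mono: "F \<subseteq> F' \<Longrightarrow> graph_component V F x \<subseteq> graph_component V F' x"
proof (cases "x \<in> V")
  case True
  assume "F \<subseteq> F'"
  then show ?thesis using True by (intro component_least component_root) (auto intro: component_step)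
next
  case False
  then have "graph_component V F x = {}"
    by (auto simp: graph_component_def elim: converse_rtranclE)
  then show ?thesis by simp
qed

lemma component_eq:
  assumes "x \<in> V" "y \<in> graph_component V F x"
  shows "graph_component V F y = graph_component V F x"
proof -
  let ?R = "{(u, v). u \<in> V \<and> v \<in> V \<and> {u, v} \<in> F}"
  have "sym ?R" by (auto simp: sym_def insert_commute)
  then have "sym (?R\<^sup>*)" by (rule sym_rtrancl)
  moreover have "(x, y) \<in> ?R\<^sup>*" using assms by (simp add: graph_component_def)
  ultimately show ?thesis unfolding graph_component_def
    by (auto intro: rtrancl_trans dest: symD)
qed

text \<open>
  A component depends only on the edges that touch it. This is used both to identify cluster events
  and to recover an animal from a larger edge set.
\<close>

lemma component_cong:
  assumes "x \<in> V"
    and "\<And>e. e \<inter> graph_component V F x \<noteq> {} \<Longrightarrow> e \<in> F \<longleftrightarrow> e \<in> F'"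
  shows "graph_component V F' x = graph_component V F x"
proof
  show "graph_component V F' x \<subseteq> graph_component V F x"
    by (rule component_least) (use assms in \<open>auto intro: component_root component_step\<close>)
  have "graph_component V F x \<subseteq> graph_component V F x \<inter> graph_component V F' x"
  proof (rule component_least)
    fix u v assume "u \<in> graph_component V F x \<inter> graph_component V F' x" "v \<in> V" "{u, v} \<in> F"
    then show "v \<in> graph_component V F x \<inter> graph_component V F' x"
      using assms(2)[of "{u, v}"] by (auto intro: component_step)
  qed (use assms in \<open>auto intro: component_root\<close>)
  then show "graph_component V F x \<subseteq> graph_component V F' x" by blast
qed

text \<open>
  The hypotheses say that each of the two edge sets is spanned by a single component, so that
  no edge of one set links the union to a third component.
\<close>

lemma component_Un:
  assumes "x \<in> V" "y \<in> V"
    and F: "\<Union>F \<subseteq> graph_component V F x" and H: "\<Union>H \<subseteq> graph_component V H y"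
    and z: "z \<in> graph_component V F x" "z \<in> graph_component V H y"
  shows "graph_component V (F \<union> H) x = graph_component V F x \<union> graph_component V H y"
proof
  show "graph_component V (F \<union> H) x \<subseteq> graph_component V F x \<union> graph_component V H y"
    by (rule component_least) (use assms in \<open>auto intro: component_root component_step\<close>)
  have "z \<in> graph_component V (F \<union> H) x" using z(1) component_mono[of F "F \<union> H"] by blast
  then have "graph_component V (F \<union> H) z = graph_component V (F \<union> H) x"
    using component_eq assms(1) by metis
  moreover have "graph_component V H y = graph_component V H z" using component_eq assms(2) z(2) by metis
  ultimately show "graph_component V F x \<union> graph_component V H y \<subseteq> graph_component V (F \<union> H) x"
    using component_mono[of F "F \<union> H" V x] component_mono[of H "F \<union> H" V z] by auto
qed

lemma component_image:
  assumes "x \<in> V" "f ` V \<subseteq> V" "inj_on f V"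
    and F: "\<And>e. e \<in> F \<Longrightarrow> e \<subseteq> V"
  shows "graph_component V ((`) f ` F) (f x) = f ` graph_component V F x"
proof
  show "graph_component V ((`) f ` F) (f x) \<subseteq> f ` graph_component V F x"
  proof (rule component_least)
    show "f x \<in> f ` graph_component V F x" using assms(1) by (simp add: component_root)
  next
    fix u v assume "u \<in> f ` graph_component V F x" "v \<in> V" "{u, v} \<in> (`) f ` F"
    then obtain a e where a: "a \<in> graph_component V F x" "u = f a" "e \<in> F" "{u, v} = f ` e" by blast
    have aV: "a \<in> V" using a component_subset by fastforce
    have "v \<in> f ` e" using a(4) by blast
    then obtain w where w: "w \<in> e" "v = f w" by blast
    have wV: "w \<in> V" using w F a(3) by blast
    have "f ` {a, w} = f ` e" using a w by simp
    then have "e = {a, w}"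
      using inj_on_image_eq_iff[OF assms(3), of "{a, w}" e] aV wV F[OF a(3)] by simp
    then have "w \<in> graph_component V F x" using a wV by (auto intro: component_step)
    then show "v \<in> f ` graph_component V F x" using w by blast
  qed
  have "graph_component V F x \<subseteq> {y. f y \<in> graph_component V ((`) f ` F) (f x)}"
  proof (rule component_least)
    show "x \<in> {y. f y \<in> graph_component V ((`) f ` F) (f x)}"
      using assms by (auto intro: component_root)
  next
    fix u v assume "u \<in> {y. f y \<in> graph_component V ((`) f ` F) (f x)}" "v \<in> V" "{u, v} \<in> F"
    moreover from this have "{f u, f v} \<in> (`) f ` F" by (intro image_eqI[of _ _ "{u, v}"]) auto
    ultimately show "v \<in> {y. f y \<in> graph_component V ((`) f ` F) (f x)}"
      using assms(2) by (auto intro: component_step)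
  qed
  then show "f ` graph_component V F x \<subseteq> graph_component V ((`) f ` F) (f x)" by blast
qed

text \<open>
  A vertex at maximal distance from the root is not on a shortest path to any other vertex, so
  removing it with its edges keeps the rest connected to the root.
\<close>

lemma removable_vertex:
  fixes V :: "'v set"
  defines "A \<equiv> \<lambda>F x. graph_component V F x"
  assumes x: "x \<in> V" and fin: "finite (A F x)" and ne: "A F x \<noteq> {x}"
  shows "\<exists>v \<in> A F x - {x}. A {e \<in> F. v \<notin> e} x = A F x - {v} \<and> (\<exists>u \<in> A F x - {v}. {u, v} \<in> F)"
proof -
  let ?R = "{(u, v). u \<in> V \<and> v \<in> V \<and> {u, v} \<in> F}"
  \<comment> \<open>the distance of \<open>y\<close> from the root\<close>
  define lv where "lv y = (LEAST n. (x, y) \<in> ?R ^^ n)" for y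
  have lv: "(x, y) \<in> ?R ^^ lv y" if "y \<in> A F x" for y
  proof -
    have "\<exists>n. (x, y) \<in> ?R ^^ n" using that by (simp add: A_def graph_component_def rtrancl_power)
    then show ?thesis unfolding lv_def by (rule LeastI_ex)
  qed
  have pred: "\<exists>u\<in>A F x. {u, y} \<in> F \<and> lv u < lv y" if "y \<in> A F x" "y \<noteq> x" for y
  proof -
    have "lv y \<noteq> 0"
    proof
      assume "lv y = 0"
      then have "(x, y) \<in> ?R ^^ 0" using lv[OF that(1)] by metis
      then show False using that(2) by simp
    qed
    then obtain n where n: "lv y = Suc n" by (cases "lv y") auto
    then have "(x, y) \<in> ?R ^^ Suc n" using lv[OF that(1)] by metis
    then obtain u where u: "(x, u) \<in> ?R ^^ n" "(u, y) \<in> ?R" by (rule relpow_Suc_E)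
    then have "lv u \<le> n" unfolding lv_def by (intro Least_le)
    moreover have "u \<in> A F x" using u by (auto simp: A_def graph_component_def relpow_imp_rtrancl)
    ultimately show ?thesis using u n by auto
  qed
  have xA: "x \<in> A F x" using x by (simp add: A_def component_root)
  obtain v where v: "v \<in> A F x" "\<And>y. y \<in> A F x \<Longrightarrow> lv y \<le> lv v"
  proof -
    have "Max (lv ` A F x) \<in> lv ` A F x" using fin xA by (intro Max_in) auto
    then obtain v where "v \<in> A F x" "lv v = Max (lv ` A F x)" by fastforce
    then show ?thesis using that[of v] fin by auto
  qed
  have vx: "v \<noteq> x"
  proof
    assume "v = x"
    obtain y where "y \<in> A F x" "y \<noteq> x" using ne xA by blast
    then have "0 < lv y" using pred by fastforce
    moreover have "lv x = 0" unfolding lv_def by (rule Least_eq_0) simp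
    ultimately show False using v(2)[OF \<open>y \<in> A F x\<close>] \<open>v = x\<close> by simp
  qed
  let ?F = "{e \<in> F. v \<notin> e}"
  have "y \<in> A ?F x" if "y \<in> A F x" "y \<noteq> v" for y
    using that
  proof (induction "lv y" arbitrary: y rule: less_induct)
    case less
    show ?case
    proof (cases "y = x")
      case True
      then show ?thesis using x by (simp add: A_def component_root)
    next
      case False
      then obtain u where u: "u \<in> A F x" "{u, y} \<in> F" "lv u < lv y" using pred less.prems by blast
      then have "u \<noteq> v" using v(2)[OF less.prems(1)] by auto
      then have "u \<in> A ?F x" using less.hyps u by blast
      moreover have "y \<in> V" using less.prems component_subset unfolding A_def by fastforce
      moreover have "{u, y} \<in> ?F" using u \<open>u \<noteq> v\<close> less.prems by auto
      ultimately show ?thesis unfolding A_def by (rule component_step)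
    qed
  qed
  moreover have "A ?F x \<subseteq> A F x - {v}"
    unfolding A_def by (rule component_least) (use vx x in \<open>auto intro: component_root component_step\<close>)
  ultimately have "A ?F x = A F x - {v}" by blast
  moreover have "\<exists>u \<in> A F x - {v}. {u, v} \<in> F" using pred[OF v(1) vx] by fastforce
  ultimately show ?thesis using v vx by blast
qed

section \<open>Animals in Cayley graphs\<close>

context cayley_graph
begin

definition edges :: "'a set set" where "edges = cayley_edges G S"

definition touch :: "'a set \<Rightarrow> 'a set set" where "touch A = {e \<in> edges. e \<inter> A \<noteq> {}}"

text \<open>
  The component with respect to an arbitrary edge set; for the set of open edges it is the open cluster.
\<close>

definition cluster :: "'a set set \<Rightarrow> 'a \<Rightarrow> 'a set" where
  "cluster F x = graph_component (carrier G) F x"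

text \<open>
  The vertices of an animal are determined by its root and its edges. Loops, which occur if the
  identity is a generator, are allowed, and the empty edge set is the animal with the root as its only vertex.
\<close>

definition animal :: "'a \<Rightarrow> 'a set set \<Rightarrow> bool" where
  "animal x F \<longleftrightarrow> F \<subseteq> edges \<and> finite F \<and> \<Union>F \<subseteq> cluster F x"

lemma edgeI: "u \<in> carrier G \<Longrightarrow> s \<in> S \<Longrightarrow> {u, s \<otimes> u} \<in> edges"
  unfolding edges_def cayley_edges_def by blast

lemma edgeE:
  assumes "e \<in> edges" obtains u s where "u \<in> carrier G" "s \<in> S" "e = {u, s \<otimes> u}"
  using assms unfolding edges_def cayley_edges_def by blast

lemma edge_carrier: "e \<in> edges \<Longrightarrow> e \<subseteq> carrier G"
  by (auto elim!: edgeE)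

lemma edge_at_vertex:
  assumes "e \<in> edges" "a \<in> e" shows "\<exists>s\<in>S. e = {a, s \<otimes> a}"
proof -
  obtain u s where e: "u \<in> carrier G" "s \<in> S" "e = {u, s \<otimes> u}" using assms edgeE by blast
  then consider "a = u" | "a = s \<otimes> u" using assms by blast
  then show ?thesis
  proof cases
    case 1
    then show ?thesis using e by blast
  next
    case 2
    then have "inv s \<otimes> a = u" using e by (simp add: m_assoc[symmetric])
    then show ?thesis using e 2 by (intro bexI[of _ "inv s"]) auto
  qed
qed

lemma touch_subset: "touch A \<subseteq> (\<lambda>(a, s). {a, s \<otimes> a}) ` (A \<times> S)"
  unfolding touch_def using edge_at_vertex by fastforce

lemma finite_touch: "finite A \<Longrightarrow> finite (touch A)"
  using touch_subset finite_S by (meson finite_SigmaI finite_imageI finite_subset)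

lemma card_touch:
  assumes "finite A" shows "card (touch A) \<le> card S * card A"
proof -
  have "card (touch A) \<le> card ((\<lambda>(a, s). {a, s \<otimes> a}) ` (A \<times> S))"
    using touch_subset finite_S assms by (intro card_mono) auto
  also have "\<dots> \<le> card (A \<times> S)" using finite_S assms by (intro card_image_le) auto
  finally show ?thesis by (simp add: card_cartesian_product mult.commute)
qed

lemma translate_edge:
  assumes "e \<in> edges" "g \<in> carrier G" shows "(\<lambda>x. x \<otimes> g) ` e \<in> edges"
proof -
  obtain u s where e: "u \<in> carrier G" "s \<in> S" "e = {u, s \<otimes> u}" using assms edgeE by blast
  then have "(\<lambda>x. x \<otimes> g) ` e = {u \<otimes> g, s \<otimes> (u \<otimes> g)}" using assms by (simp add: m_assoc)
  then show ?thesis using edgeI[of "u \<otimes> g" s] e assms by simp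
qed

lemma translate_inj: "g \<in> carrier G \<Longrightarrow> inj_on (\<lambda>x. x \<otimes> g) (carrier G)"
  by (rule inj_onI) simp

lemma translate_back:
  "g \<in> carrier G \<Longrightarrow> A \<subseteq> carrier G \<Longrightarrow> (\<lambda>x. x \<otimes> inv g) ` (\<lambda>x. x \<otimes> g) ` A = A"
  by (force simp: image_image m_assoc subset_iff)

lemma translate_forth:
  "g \<in> carrier G \<Longrightarrow> A \<subseteq> carrier G \<Longrightarrow> (\<lambda>x. x \<otimes> g) ` (\<lambda>x. x \<otimes> inv g) ` A = A"
  using translate_back[of "inv g" A] by simp

lemma translate_inj_sets: "g \<in> carrier G \<Longrightarrow> inj_on ((`) (\<lambda>x. x \<otimes> g)) (Pow (carrier G))"
  by (rule inj_on_inverseI[of _ "(`) (\<lambda>x. x \<otimes> inv g)"]) (simp add: translate_back)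

lemma touch_translate:
  assumes g: "g \<in> carrier G" and A: "A \<subseteq> carrier G"
  shows "touch ((\<lambda>x. x \<otimes> g) ` A) = (`) (\<lambda>x. x \<otimes> g) ` touch A"
proof
  show "(`) (\<lambda>x. x \<otimes> g) ` touch A \<subseteq> touch ((\<lambda>x. x \<otimes> g) ` A)"
    unfolding touch_def using translate_edge g by fastforce
  show "touch ((\<lambda>x. x \<otimes> g) ` A) \<subseteq> (`) (\<lambda>x. x \<otimes> g) ` touch A"
  proof
    fix e assume "e \<in> touch ((\<lambda>x. x \<otimes> g) ` A)"
    then obtain a where e: "e \<in> edges" "a \<in> A" "a \<otimes> g \<in> e" unfolding touch_def by blast
    have "(\<lambda>x. x \<otimes> inv g) ` e \<in> edges" using e g translate_edge by auto
    moreover have "a \<in> (\<lambda>x. x \<otimes> inv g) ` e"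
      using e g A by (intro image_eqI[of _ _ "a \<otimes> g"]) (auto simp: m_assoc subset_iff)
    ultimately have "(\<lambda>x. x \<otimes> inv g) ` e \<in> touch A" using e unfolding touch_def by blast
    moreover have "e = (\<lambda>x. x \<otimes> g) ` (\<lambda>x. x \<otimes> inv g) ` e"
      using translate_forth[OF g edge_carrier[OF e(1)]] by simp
    ultimately show "e \<in> (`) (\<lambda>x. x \<otimes> g) ` touch A" by blast
  qed
qed

lemma cluster_carrier: "cluster F x \<subseteq> carrier G"
  unfolding cluster_def by (rule component_subset)

lemma cluster_root: "x \<in> carrier G \<Longrightarrow> x \<in> cluster F x"
  unfolding cluster_def by (rule component_root)

lemma animal_finite_cluster:
  assumes "animal x F" shows "finite (cluster F x)" "card (cluster F x) \<le> 2 * card F + 1"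
proof -
  have "cluster F x \<subseteq> insert x (\<Union>F)"
    unfolding cluster_def by (rule component_least) auto
  have edge: "finite e \<and> card e \<le> 2" if "e \<in> F" for e
    using that assms unfolding animal_def
    by (auto elim!: edgeE dest!: subsetD simp: card_insert_if)
  have finF: "finite F" using assms unfolding animal_def by blast
  have fin: "finite (\<Union>F)" using edge finF by blast
  have "card (\<Union>F) \<le> (\<Sum>e\<in>F. card e)" using card_Union_le_sum_card[of F] edge by blast
  also have "\<dots> \<le> (\<Sum>e\<in>F. 2)" by (intro sum_mono) (use edge in auto)
  finally have "card (\<Union>F) \<le> 2 * card F" by simp
  moreover have "card (insert x (\<Union>F)) \<le> card (\<Union>F) + 1" using fin by (simp add: card_insert_if)
  moreover have "card (cluster F x) \<le> card (insert x (\<Union>F))"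
    using \<open>cluster F x \<subseteq> _\<close> fin by (intro card_mono) auto
  ultimately show "card (cluster F x) \<le> 2 * card F + 1" by linarith
  show "finite (cluster F x)" using \<open>cluster F x \<subseteq> _\<close> fin finite_subset by blast
qed

lemma animal_touch:
  assumes "animal x F" shows "F \<subseteq> touch (cluster F x)"
proof
  fix e assume e: "e \<in> F"
  then have "e \<in> edges" "e \<subseteq> cluster F x" using assms unfolding animal_def by auto
  then show "e \<in> touch (cluster F x)" unfolding touch_def by (auto elim: edgeE)
qed

lemma animal_card_le:
  assumes "animal x F" shows "card F \<le> card S * card (cluster F x)"
  using card_mono[OF finite_touch animal_touch[OF assms]] card_touch animal_finite_cluster[OF assms]
  by (meson order_trans)

lemma animal_empty: "x \<in> carrier G \<Longrightarrow> animal x {} \<and> cluster {} x = {x}"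
  unfolding animal_def cluster_def
  using component_root[of x "carrier G" "{}"] component_least[of x "{x}" "carrier G" "{}"] by auto

lemma animal_Un:
  assumes "animal x F" "animal y H" "x \<in> carrier G" "y \<in> carrier G" "cluster F x \<inter> cluster H y \<noteq> {}"
  shows "animal x (F \<union> H)" "cluster (F \<union> H) x = cluster F x \<union> cluster H y"
proof -
  obtain z where z: "z \<in> cluster F x" "z \<in> cluster H y" using assms by blast
  show eq: "cluster (F \<union> H) x = cluster F x \<union> cluster H y"
    using component_Un[of x "carrier G" y F H z] assms z unfolding animal_def cluster_def by simp
  show "animal x (F \<union> H)" using assms unfolding animal_def eq by auto
qed

lemma animal_edge:
  assumes "u \<in> carrier G" "s \<in> S"
  shows "animal u {{u, s \<otimes> u}}" "cluster {{u, s \<otimes> u}} u = {u, s \<otimes> u}"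
proof -
  have "s \<otimes> u \<in> cluster {{u, s \<otimes> u}} u"
    unfolding cluster_def using assms by (intro component_step[OF component_root]) auto
  moreover have "cluster {{u, s \<otimes> u}} u \<subseteq> {u, s \<otimes> u}"
    unfolding cluster_def by (rule component_least) (auto simp: doubleton_eq_iff)
  ultimately show eq: "cluster {{u, s \<otimes> u}} u = {u, s \<otimes> u}"
    using cluster_root assms by auto
  show "animal u {{u, s \<otimes> u}}" unfolding animal_def eq using assms edgeI by auto
qed

lemma path_animal:
  assumes "x \<in> carrier G" "h \<in> word_ball k"
  shows "\<exists>Q. animal x Q \<and> h \<otimes> x \<in> cluster Q x \<and> card Q \<le> k"
  using assms(2)
proof (induction k arbitrary: h)
  case 0
  then show ?case using animal_empty[OF assms(1)] assms(1) by (intro exI[of _ "{}"]) auto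
next
  case (Suc k)
  show ?case
  proof (cases "h \<in> word_ball k")
    case True
    then show ?thesis using Suc.IH le_SucI by blast
  next
    case False
    then obtain s w where h: "s \<in> S" "w \<in> word_ball k" "h = s \<otimes> w" using Suc.prems by auto
    then obtain Q where Q: "animal x Q" "w \<otimes> x \<in> cluster Q x" "card Q \<le> k" using Suc.IH by blast
    have w: "w \<in> carrier G" "w \<otimes> x \<in> carrier G" using h assms by auto
    note e = animal_edge[OF w(2) h(1)]
    let ?Q = "Q \<union> {{w \<otimes> x, s \<otimes> (w \<otimes> x)}}"
    have "animal x ?Q" "cluster ?Q x = cluster Q x \<union> {w \<otimes> x, s \<otimes> (w \<otimes> x)}"
      using animal_Un[OF Q(1) e(1) assms(1) w(2)] Q(2) e(2) by auto
    moreover have "card ?Q \<le> Suc k" using Q(1,3) by (auto simp: animal_def card_insert_if)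
    moreover have "h \<otimes> x = s \<otimes> (w \<otimes> x)" using h w assms by (simp add: m_assoc)
    ultimately show ?thesis by blast
  qed
qed

lemma animal_translate:
  assumes g: "g \<in> carrier G" and F: "animal \<one> F"
  shows "animal g ((`) (\<lambda>x. x \<otimes> g) ` F)"
    "cluster ((`) (\<lambda>x. x \<otimes> g) ` F) g = (\<lambda>x. x \<otimes> g) ` cluster F \<one>"
proof -
  have "cluster ((`) (\<lambda>x. x \<otimes> g) ` F) (\<one> \<otimes> g) = (\<lambda>x. x \<otimes> g) ` cluster F \<one>"
    unfolding cluster_def
    by (rule component_image)
       (use g F edge_carrier translate_inj in \<open>auto simp: animal_def\<close>)
  then show eq: "cluster ((`) (\<lambda>x. x \<otimes> g) ` F) g = (\<lambda>x. x \<otimes> g) ` cluster F \<one>" using g by simp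
  show "animal g ((`) (\<lambda>x. x \<otimes> g) ` F)"
    unfolding animal_def eq using F translate_edge g by (auto simp: animal_def)
qed

text \<open>
  The decoding map for merged animals: the edges of \<open>H\<close> in the component of \<open>x\<close>.
\<close>

definition touching_part :: "'a set set \<Rightarrow> 'a \<Rightarrow> 'a set set" where
  "touching_part H x = {e \<in> H. e \<inter> cluster H x \<noteq> {}}"

text \<open>
  Deleting from \<open>H\<close> the edges that touch the cluster of \<open>F\<close> without belonging to \<open>F\<close> isolates \<open>F\<close> from
  the remainder of \<open>H\<close>. So \<open>F\<close> is determined by \<open>H\<close>, the root and the set of deleted edges.
\<close>

lemma animal_recover:
  assumes "animal x F" "x \<in> carrier G" "F \<subseteq> H" "H \<subseteq> edges"
  shows "touching_part (H - {e \<in> H - F. e \<inter> cluster F x \<noteq> {}}) x = F"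
proof -
  have F: "e \<inter> cluster F x \<noteq> {}" if "e \<in> F" for e
    using animal_touch[OF assms(1)] that unfolding touch_def by blast
  let ?H = "H - {e \<in> H - F. e \<inter> cluster F x \<noteq> {}}"
  have "cluster ?H x = cluster F x"
    unfolding cluster_def by (rule component_cong) (use assms in auto)
  then show ?thesis unfolding touching_part_def using F assms(3) by auto
qed

lemma animal_remove_vertex:
  assumes F: "animal \<one> F" and two: "card (cluster F \<one>) \<ge> 2"
  shows "\<exists>v \<in> cluster F \<one>. animal \<one> (F - touch {v}) \<and> cluster (F - touch {v}) \<one> = cluster F \<one> - {v}
           \<and> (\<exists>u \<in> cluster (F - touch {v}) \<one>. \<exists>s\<in>S. v = s \<otimes> u)"
proof -
  have "cluster F \<one> \<noteq> {\<one>}" using two by auto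
  then obtain v where v: "v \<in> cluster F \<one> - {\<one>}" "cluster {e \<in> F. v \<notin> e} \<one> = cluster F \<one> - {v}"
    and u: "\<exists>u \<in> cluster F \<one> - {v}. {u, v} \<in> F"
    using removable_vertex[of \<one> "carrier G" F] animal_finite_cluster[OF F] unfolding cluster_def by auto
  have FE: "F \<subseteq> edges" using F by (simp add: animal_def)
  have eq: "F - touch {v} = {e \<in> F. v \<notin> e}" unfolding touch_def using FE by auto
  obtain u where u: "u \<in> cluster F \<one> - {v}" "{u, v} \<in> F" using u by blast
  then obtain s where s: "s \<in> S" "{u, v} = {u, s \<otimes> u}" using edge_at_vertex[of "{u, v}" u] FE by blast
  then have "v = s \<otimes> u" using u(1) by (auto simp: doubleton_eq_iff)
  moreover have "animal \<one> {e \<in> F. v \<notin> e}"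
    using F unfolding animal_def v(2) by auto
  ultimately have b: "\<exists>u \<in> cluster (F - touch {v}) \<one>. \<exists>s\<in>S. v = s \<otimes> u" and a: "animal \<one> (F - touch {v})"
    unfolding eq v(2) using u(1) s(1) by auto
  have c: "cluster (F - touch {v}) \<one> = cluster F \<one> - {v}" unfolding eq v(2) ..
  show ?thesis using v(1) by (intro bexI[of _ v] conjI[OF a conjI[OF c b]]) simp
qed

end

section \<open>The cluster size distribution as a sum over animals\<close>

context cayley_graph
begin

text \<open>
  The probability that, among all edges touching the cluster of \<open>F\<close>, exactly those of \<open>F\<close> are open.
\<close>

definition weight :: "real \<Rightarrow> 'a set set \<Rightarrow> 'a \<Rightarrow> real" where
  "weight p F x = p ^ card F * (1 - p) ^ card (touch (cluster F x) - F)"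

definition animals :: "nat \<Rightarrow> 'a set set set" where
  "animals n = {F. animal \<one> F \<and> card (cluster F \<one>) = n}"

text \<open>
  The vertices at distance at most one; a vertex removed from an animal lies in the halo of the rest.
\<close>

definition halo :: "'a set \<Rightarrow> 'a set" where
  "halo A = A \<union> (\<lambda>(s, u). s \<otimes> u) ` (S \<times> A)"

lemma finite_halo: "finite A \<Longrightarrow> finite (halo A)"
  unfolding halo_def using finite_S by auto

lemma card_halo:
  assumes "finite A" shows "card (halo A) \<le> (card S + 1) * card A"
proof -
  have "card ((\<lambda>(s, u). s \<otimes> u) ` (S \<times> A)) \<le> card S * card A"
    using card_image_le[of "S \<times> A"] finite_S assms by (simp add: card_cartesian_product)
  then show ?thesis unfolding halo_def
    using card_Un_le[of A "(\<lambda>(s, u). s \<otimes> u) ` (S \<times> A)"] by simp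
qed

text \<open>
  By induction on the size: removing a suitable vertex leaves a smaller animal, and all edges of the
  original one touch the halo of the smaller one.
\<close>

lemma finite_animals: "finite (animals n)"
proof (induction n)
  case 0
  have "animals 0 = {}"
    unfolding animals_def using animal_finite_cluster(1) cluster_root[OF one_closed] by fastforce
  then show ?case by simp
next
  case (Suc n)
  let ?U = "\<lambda>F'. Pow (touch (halo (cluster F' \<one>)))"
  have "animals (Suc n) \<subseteq> Pow (touch {\<one>}) \<union> (\<Union>F'\<in>animals n. ?U F')"
  proof
    fix F assume "F \<in> animals (Suc n)"
    then have F: "animal \<one> F" "card (cluster F \<one>) = Suc n" unfolding animals_def by auto
    show "F \<in> Pow (touch {\<one>}) \<union> (\<Union>F'\<in>animals n. ?U F')"
    proof (cases "n = 0")
      case True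
      then have "cluster F \<one> = {\<one>}"
        using F cluster_root[of \<one> F] by (auto simp: card_1_singleton_iff)
      then show ?thesis using animal_touch[OF F(1)] by simp
    next
      case False
      then obtain v u s where v: "v \<in> cluster F \<one>" "animal \<one> (F - touch {v})"
        "cluster (F - touch {v}) \<one> = cluster F \<one> - {v}"
        "u \<in> cluster (F - touch {v}) \<one>" "s \<in> S" "v = s \<otimes> u"
        using animal_remove_vertex[of F] F by auto
      have "cluster F \<one> \<subseteq> halo (cluster (F - touch {v}) \<one>)"
        unfolding halo_def v(3) using v by force
      then have "F \<in> ?U (F - touch {v})"
        using animal_touch[OF F(1)] unfolding touch_def by blast
      moreover have "F - touch {v} \<in> animals n"
        using v F animal_finite_cluster(1)[OF F(1)] unfolding animals_def by simp
      ultimately show ?thesis by blast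
    qed
  qed
  moreover have "finite (?U F')" if "F' \<in> animals n" for F'
    using that animal_finite_cluster(1) finite_halo finite_touch unfolding animals_def by blast
  ultimately show ?case using Suc finite_touch by (meson finite.emptyI finite.insertI finite_Pow_iff finite_UN finite_Un finite_subset)
qed

lemma prob_cylinder:
  assumes p: "0 \<le> p" "p \<le> 1" and J: "finite J" "J \<subseteq> edges" "F \<subseteq> J"
  shows "{\<omega> \<in> space (bond_percolation edges p). \<forall>e\<in>J. \<omega> e \<longleftrightarrow> e \<in> F} \<in> sets (bond_percolation edges p)"
    "measure (bond_percolation edges p) {\<omega> \<in> space (bond_percolation edges p). \<forall>e\<in>J. \<omega> e \<longleftrightarrow> e \<in> F} =
      p ^ card F * (1 - p) ^ card (J - F)"
proof -
  interpret P: product_prob_space "\<lambda>_. measure_pmf (bernoulli_pmf p)" edges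
    by unfold_locales
  have eq: "{\<omega> \<in> space (bond_percolation edges p). \<forall>e\<in>J. \<omega> e \<longleftrightarrow> e \<in> F} =
      prod_emb edges (\<lambda>_. measure_pmf (bernoulli_pmf p)) J (Pi\<^sub>E J (\<lambda>e. {e \<in> F}))"
    unfolding prod_emb_def bond_percolation_def using J by (auto simp: space_PiM PiE_iff extensional_def)
  show "{\<omega> \<in> space (bond_percolation edges p). \<forall>e\<in>J. \<omega> e \<longleftrightarrow> e \<in> F} \<in> sets (bond_percolation edges p)"
    unfolding eq unfolding bond_percolation_def using J by (intro sets_PiM_I) auto
  have "measure (bond_percolation edges p) {\<omega> \<in> space (bond_percolation edges p). \<forall>e\<in>J. \<omega> e \<longleftrightarrow> e \<in> F} =
      (\<Prod>e\<in>J. measure (measure_pmf (bernoulli_pmf p)) {e \<in> F})"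
    unfolding eq unfolding bond_percolation_def using J by (intro P.measure_PiM_emb) auto
  also have "\<dots> = (\<Prod>e\<in>J. if e \<in> F then p else 1 - p)"
    using p by (intro prod.cong) (auto simp: measure_pmf_single)
  also have "\<dots> = p ^ card (J \<inter> F) * (1 - p) ^ card (J \<inter> - F)"
    using J by (simp add: prod.If_cases)
  also have "J \<inter> F = F" using J by blast
  also have "J \<inter> - F = J - F" by blast
  finally show "measure (bond_percolation edges p) {\<omega> \<in> space (bond_percolation edges p). \<forall>e\<in>J. \<omega> e \<longleftrightarrow> e \<in> F} =
      p ^ card F * (1 - p) ^ card (J - F)" .
qed

text \<open>
  A configuration with a finite open cluster lies in the event of exactly one animal, namely the set of
  open edges that touch the cluster.
\<close>

theorem cluster_size_prob_eq_sum:
  assumes p: "0 \<le> p" "p \<le> 1"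
  shows "cluster_size_prob G S p n = (\<Sum>F\<in>animals n. weight p F \<one>)"
proof -
  let ?M = "bond_percolation edges p"
  define Op where "Op \<omega> = {e \<in> edges. \<omega> e}" for \<omega> :: "'a set \<Rightarrow> bool"
  define Ev where "Ev F = {\<omega> \<in> space ?M. \<forall>e\<in>touch (cluster F \<one>). \<omega> e \<longleftrightarrow> e \<in> F}" for F
  have oc: "open_cluster (carrier G) edges \<omega> \<one> = cluster (Op \<omega>) \<one>" for \<omega>
    unfolding open_cluster_def cluster_def Op_def by simp
  have EvF: "cluster (Op \<omega>) \<one> = cluster F \<one>" "F = touching_part (Op \<omega>) \<one>"
    if "animal \<one> F" "\<omega> \<in> Ev F" for \<omega> F
  proof -
    have ev: "\<omega> e \<longleftrightarrow> e \<in> F" if "e \<in> edges" "e \<inter> cluster F \<one> \<noteq> {}" for e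
      using that \<open>\<omega> \<in> Ev F\<close> unfolding Ev_def touch_def by blast
    have FE: "F \<subseteq> edges" using that(1) unfolding animal_def by blast
    show eq: "cluster (Op \<omega>) \<one> = cluster F \<one>"
      unfolding cluster_def
      by (rule component_cong) (use ev FE in \<open>auto simp: Op_def cluster_def\<close>)
    show "F = touching_part (Op \<omega>) \<one>"
      unfolding touching_part_def eq using animal_touch[OF that(1)] ev FE
      by (auto simp: Op_def touch_def)
  qed
  have ex: "\<exists>F\<in>animals n. \<omega> \<in> Ev F"
    if \<omega>: "\<omega> \<in> space ?M" "finite (cluster (Op \<omega>) \<one>)" "card (cluster (Op \<omega>) \<one>) = n" for \<omega>
  proof -
    define F where "F = touching_part (Op \<omega>) \<one>"
    have eq: "cluster F \<one> = cluster (Op \<omega>) \<one>"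
      unfolding cluster_def
      by (rule component_cong) (auto simp: F_def touching_part_def cluster_def)
    have sub: "F \<subseteq> touch (cluster (Op \<omega>) \<one>)"
      unfolding F_def touching_part_def Op_def touch_def by blast
    have "e \<subseteq> cluster (Op \<omega>) \<one>" if e: "e \<in> F" for e
    proof -
      obtain a where a: "a \<in> e" "a \<in> cluster (Op \<omega>) \<one>" "e \<in> edges" "e \<in> Op \<omega>"
        using e unfolding F_def touching_part_def Op_def by blast
      then obtain s where s: "e = {a, s \<otimes> a}" using edge_at_vertex by blast
      then have "s \<otimes> a \<in> cluster (Op \<omega>) \<one>"
        using a edge_carrier[OF a(3)] unfolding cluster_def by (auto intro: component_step)
      then show ?thesis using s a by simp
    qed
    then have "animal \<one> F"
      unfolding animal_def eq using sub finite_touch[OF \<omega>(2)] finite_subset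
      by (auto simp: touch_def)
    moreover have "\<omega> \<in> Ev F"
      unfolding Ev_def eq using \<omega>(1) by (auto simp: F_def touching_part_def touch_def Op_def)
    ultimately show ?thesis using eq \<omega>(3) unfolding animals_def by auto
  qed
  have sets: "Ev F \<in> sets ?M" and meas: "measure ?M (Ev F) = weight p F \<one>" if F: "F \<in> animals n" for F
  proof -
    have *: "finite (touch (cluster F \<one>))" "touch (cluster F \<one>) \<subseteq> edges" "F \<subseteq> touch (cluster F \<one>)"
      using F animal_touch animal_finite_cluster finite_touch unfolding animals_def by (auto simp: touch_def)
    show "Ev F \<in> sets ?M" "measure ?M (Ev F) = weight p F \<one>"
      unfolding Ev_def weight_def using prob_cylinder[OF p *] by auto
  qed
  interpret P: prob_space ?M
    unfolding bond_percolation_def by (intro prob_space_PiM) unfold_locales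
  have "cluster_size_prob G S p n =
      measure ?M {\<omega> \<in> space ?M. finite (cluster (Op \<omega>) \<one>) \<and> card (cluster (Op \<omega>) \<one>) = n}"
    unfolding cluster_size_prob_def edges_def[symmetric] oc ..
  also have "{\<omega> \<in> space ?M. finite (cluster (Op \<omega>) \<one>) \<and> card (cluster (Op \<omega>) \<one>) = n} =
      (\<Union>F\<in>animals n. Ev F)"
  proof (intro equalityI subsetI)
    fix \<omega> assume "\<omega> \<in> (\<Union>F\<in>animals n. Ev F)"
    then obtain F where "animal \<one> F" "card (cluster F \<one>) = n" "\<omega> \<in> Ev F" unfolding animals_def by blast
    then show "\<omega> \<in> {\<omega> \<in> space ?M. finite (cluster (Op \<omega>) \<one>) \<and> card (cluster (Op \<omega>) \<one>) = n}"
      using EvF(1)[of F \<omega>] animal_finite_cluster(1)[of \<one> F] unfolding Ev_def by auto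
  qed (use ex in blast)
  also have "measure ?M (\<Union>F\<in>animals n. Ev F) = (\<Sum>F\<in>animals n. measure ?M (Ev F))"
  proof (rule P.finite_measure_finite_Union)
    have "F = F'" if "F \<in> animals n" "F' \<in> animals n" "\<omega> \<in> Ev F" "\<omega> \<in> Ev F'" for F F' \<omega>
    proof -
      have "animal \<one> F" "animal \<one> F'" using that unfolding animals_def by auto
      then show ?thesis using EvF(2)[of F \<omega>] EvF(2)[of F' \<omega>] that by simp
    qed
    then show "disjoint_family_on Ev (animals n)"
      unfolding disjoint_family_on_def by blast
  qed (use finite_animals sets in auto)
  also have "\<dots> = (\<Sum>F\<in>animals n. weight p F \<one>)" by (intro sum.cong) (auto simp: meas)
  finally show ?thesis .
qed

end

section \<open>Merging two animals\<close>

text \<open>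
  The form in which all comparisons between sums over animals are made: \<open>\<Phi>\<close> modifies an object \<open>x\<close> into
  \<open>fst (\<Phi> x)\<close> and stores in \<open>snd (\<Phi> x)\<close> what is needed to undo the modification. The loss is the factor
  \<open>c\<close> in the weight and the number \<open>M\<close> of possible values of the stored information.
\<close>

lemma weighted_injection_bound:
  fixes wX :: "'x \<Rightarrow> real" and wY :: "'y \<Rightarrow> real" and Z :: "'y \<Rightarrow> 'z set"
  assumes "finite X" "finite Y" and inj: "inj_on \<Phi> X"
    and maps: "\<And>x. x \<in> X \<Longrightarrow> \<Phi> x \<in> Sigma Y Z"
    and Z: "\<And>y. y \<in> Y \<Longrightarrow> finite (Z y) \<and> card (Z y) \<le> M"
    and w: "\<And>x. x \<in> X \<Longrightarrow> c * wX x \<le> wY (fst (\<Phi> x))"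
    and nonneg: "\<And>y. y \<in> Y \<Longrightarrow> 0 \<le> wY y"
  shows "c * sum wX X \<le> real M * sum wY Y"
proof -
  have "c * sum wX X = (\<Sum>x\<in>X. c * wX x)" by (simp add: sum_distrib_left)
  also have "\<dots> \<le> (\<Sum>x\<in>X. wY (fst (\<Phi> x)))" by (intro sum_mono w)
  also have "\<dots> = (\<Sum>q\<in>\<Phi> ` X. wY (fst q))" by (simp add: sum.reindex[OF inj])
  also have "\<dots> \<le> (\<Sum>q\<in>Sigma Y Z. wY (fst q))"
  proof (rule sum_mono2)
    show "finite (Sigma Y Z)" using assms by auto
    show "\<Phi> ` X \<subseteq> Sigma Y Z" using maps by blast
    show "0 \<le> wY (fst q)" if "q \<in> Sigma Y Z - \<Phi> ` X" for q using nonneg that by auto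
  qed
  also have "\<dots> = (\<Sum>y\<in>Y. \<Sum>z\<in>Z y. wY y)"
    using assms by (subst sum.Sigma) (auto simp: case_prod_unfold)
  also have "\<dots> = (\<Sum>y\<in>Y. real (card (Z y)) * wY y)" by simp
  also have "\<dots> \<le> (\<Sum>y\<in>Y. real M * wY y)" using Z nonneg by (intro sum_mono mult_right_mono) auto
  finally show ?thesis by (simp add: sum_distrib_left)
qed

lemma card_bounded_subsets:
  assumes "finite X"
  shows "card {D. D \<subseteq> X \<and> card D \<le> s} \<le> (card X + 1) ^ s"
proof (induction s)
  case 0
  have "{D. D \<subseteq> X \<and> card D \<le> 0} \<subseteq> {{}}" using assms finite_subset by fastforce
  then have "card {D. D \<subseteq> X \<and> card D \<le> 0} \<le> card {{} :: 'a set}" by (intro card_mono) auto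
  then show ?case by simp
next
  case (Suc s)
  let ?P = "\<lambda>s. {D. D \<subseteq> X \<and> card D \<le> s}"
  have fin: "finite (?P s)" using assms by auto
  have "?P (Suc s) \<subseteq> ?P s \<union> (\<lambda>(D, x). insert x D) ` (?P s \<times> X)"
  proof
    fix D assume D: "D \<in> ?P (Suc s)"
    then have finD: "finite D" using assms finite_subset by blast
    show "D \<in> ?P s \<union> (\<lambda>(D, x). insert x D) ` (?P s \<times> X)"
    proof (cases "D = {}")
      case False
      then obtain x where x: "x \<in> D" by blast
      then have "D = insert x (D - {x})" "card (D - {x}) \<le> s" using D finD by auto
      then have "D \<in> (\<lambda>(D, x). insert x D) ` (?P s \<times> X)"
        using D x by (intro image_eqI[of _ _ "(D - {x}, x)"]) auto
      then show ?thesis by blast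
    qed simp
  qed
  then have "card (?P (Suc s)) \<le> card (?P s \<union> (\<lambda>(D, x). insert x D) ` (?P s \<times> X))"
    using fin assms by (intro card_mono) auto
  also have "\<dots> \<le> card (?P s) + card ((\<lambda>(D, x). insert x D) ` (?P s \<times> X))" by (rule card_Un_le)
  also have "card ((\<lambda>(D, x). insert x D) ` (?P s \<times> X)) \<le> card (?P s \<times> X)"
    using fin assms by (intro card_image_le) auto
  also have "card (?P s) + card (?P s \<times> X) = card (?P s) * (card X + 1)"
    by (simp add: card_cartesian_product)
  also have "\<dots> \<le> (card X + 1) ^ s * (card X + 1)" using Suc by (intro mult_le_mono1)
  finally show ?case by (simp add: algebra_simps)
qed

context cayley_graph
begin

lemma weight_nonneg: "0 \<le> p \<Longrightarrow> p \<le> 1 \<Longrightarrow> 0 \<le> weight p F x"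
  unfolding weight_def by simp

lemma weight_pos: "0 < p \<Longrightarrow> p < 1 \<Longrightarrow> 0 < weight p F x"
  unfolding weight_def by simp

definition animal_sum :: "real \<Rightarrow> nat \<Rightarrow> real" where
  "animal_sum p n = (\<Sum>F\<in>animals n. weight p F \<one>)"

text \<open>
  An edge of \<open>F \<union> Q \<union> H\<close> outside \<open>F\<close> and \<open>Q\<close> belongs to \<open>H\<close>, so both its ends lie in \<open>B\<close>; if it touches
  the cluster of \<open>F\<close>, it does so in a vertex of the overlap.
\<close>

lemma card_touching_shared_le:
  assumes F: "animal x F" and H: "\<Union>H \<subseteq> B" "H \<subseteq> edges" and Q: "finite Q"
  shows "card {e \<in> F \<union> Q \<union> H - F. e \<inter> cluster F x \<noteq> {}} \<le> card S * card (cluster F x \<inter> B) + card Q"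
proof -
  have fin: "finite (cluster F x \<inter> B)" using animal_finite_cluster[OF F] by blast
  have "{e \<in> F \<union> Q \<union> H - F. e \<inter> cluster F x \<noteq> {}} \<subseteq> touch (cluster F x \<inter> B) \<union> Q"
    unfolding touch_def using H by blast
  then have "card {e \<in> F \<union> Q \<union> H - F. e \<inter> cluster F x \<noteq> {}} \<le> card (touch (cluster F x \<inter> B) \<union> Q)"
    using fin finite_touch Q by (intro card_mono) auto
  also have "\<dots> \<le> card (touch (cluster F x \<inter> B)) + card Q" by (rule card_Un_le)
  also have "\<dots> \<le> card S * card (cluster F x \<inter> B) + card Q"
    using card_touch[OF fin] by simp
  finally show ?thesis .
qed

text \<open>
  Edges shared by two of the parts, and closed edges that become open, occur only once in the union
  but in several of the factors, and as \<open>p\<close> and \<open>1 - p\<close> are at most one, this can only increase the weight.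
  Besides the weights of \<open>F\<close> and \<open>H\<close> one has to pay for the edges of \<open>Q\<close> and for the closed edges touching
  the at most \<open>2 * k + 1\<close> vertices of \<open>Q\<close>.
\<close>

lemma weight_Un_ge:
  assumes p: "0 \<le> p" "p \<le> 1"
    and F: "animal x F" and H: "animal y H" and Q: "animal a Q" "card Q \<le> k"
    and eq: "cluster (F \<union> Q \<union> H) x = cluster F x \<union> cluster Q a \<union> cluster H y"
  shows "p ^ k * (1 - p) ^ (card S * (2 * k + 1)) * (weight p F x * weight p H y)
           \<le> weight p (F \<union> Q \<union> H) x"
proof -
  let ?n = "card F + k + card H"
  let ?m = "card (touch (cluster F x) - F) + card S * (2 * k + 1) + card (touch (cluster H y) - H)"
  have "card (F \<union> Q \<union> H) \<le> card F + card Q + card H"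
    using card_Un_le[of "F \<union> Q" H] card_Un_le[of F Q] by linarith
  then have 1: "card (F \<union> Q \<union> H) \<le> ?n" using Q by linarith
  have fin: "finite (cluster F x)" "finite (cluster H y)" "finite (cluster Q a)"
    using F H Q animal_finite_cluster by auto
  have "touch (cluster (F \<union> Q \<union> H) x) - (F \<union> Q \<union> H) \<subseteq>
      (touch (cluster F x) - F) \<union> touch (cluster Q a) \<union> (touch (cluster H y) - H)"
    unfolding eq touch_def by blast
  then have "card (touch (cluster (F \<union> Q \<union> H) x) - (F \<union> Q \<union> H)) \<le>
      card ((touch (cluster F x) - F) \<union> touch (cluster Q a) \<union> (touch (cluster H y) - H))"
    using fin finite_touch by (intro card_mono) auto
  also have "\<dots> \<le> card (touch (cluster F x) - F) + card (touch (cluster Q a)) + card (touch (cluster H y) - H)"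
    using card_Un_le[of "(touch (cluster F x) - F) \<union> touch (cluster Q a)" "touch (cluster H y) - H"]
      card_Un_le[of "touch (cluster F x) - F" "touch (cluster Q a)"] by linarith
  also have "card (touch (cluster Q a)) \<le> card S * (2 * k + 1)"
  proof -
    have "card (cluster Q a) \<le> 2 * k + 1" using animal_finite_cluster(2)[OF Q(1)] Q(2) by linarith
    then have "card S * card (cluster Q a) \<le> card S * (2 * k + 1)" by (rule mult_le_mono2)
    then show ?thesis using card_touch[OF fin(3)] by linarith
  qed
  finally have 2: "card (touch (cluster (F \<union> Q \<union> H) x) - (F \<union> Q \<union> H)) \<le> ?m" by simp
  have "p ^ k * (1 - p) ^ (card S * (2 * k + 1)) * (weight p F x * weight p H y) = p ^ ?n * (1 - p) ^ ?m"
    unfolding weight_def by (simp add: power_add)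
  also have "\<dots> \<le> weight p (F \<union> Q \<union> H) x"
    unfolding weight_def using p 1 2 by (intro mult_mono power_decreasing) auto
  finally show ?thesis .
qed

text \<open>
  Equality holds, as translations are automorphisms; the inequality is the direction that merging needs.
\<close>

lemma weight_translate_ge:
  assumes p: "0 \<le> p" "p \<le> 1" and g: "g \<in> carrier G" and F: "animal \<one> F"
  shows "weight p F \<one> \<le> weight p ((`) (\<lambda>x. x \<otimes> g) ` F) g"
proof -
  let ?t = "(`) (\<lambda>x. x \<otimes> g)"
  have fin: "finite F" "finite (touch (cluster F \<one>))"
    using F animal_finite_cluster finite_touch unfolding animal_def by auto
  have "touch (cluster (?t ` F) g) - ?t ` F \<subseteq> ?t ` (touch (cluster F \<one>) - F)"
    unfolding animal_translate(2)[OF g F] touch_translate[OF g cluster_carrier] by (rule image_diff_subset)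
  then have "card (touch (cluster (?t ` F) g) - ?t ` F) \<le> card (?t ` (touch (cluster F \<one>) - F))"
    using fin by (intro card_mono) auto
  also have "\<dots> \<le> card (touch (cluster F \<one>) - F)" using fin by (intro card_image_le) auto
  finally show ?thesis unfolding weight_def
    using p card_image_le[OF fin(1), of ?t] by (intro mult_mono power_decreasing) auto
qed

text \<open>
  A pair of animals is sent to the union of the first one, a path \<open>Q\<close> with at most \<open>k\<close> edges, and a
  translate of the second one by \<open>g\<close>. To undo this it suffices to store \<open>g\<close>, which is a vertex of the union,
  and for each of the two parts the set of edges that have to be deleted to isolate it. By
  \<open>card_touching_shared_le\<close>, each set has at most \<open>card S * t + k\<close> elements, where \<open>t\<close> bounds the overlap.
  The index set \<open>J\<close> contains the possible sizes of the union, and \<open>L\<close> bounds them.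
\<close>

theorem merge_bound:
  assumes p: "0 \<le> p" "p \<le> 1"
    and glue: "\<And>F1 F2. F1 \<in> animals n \<Longrightarrow> F2 \<in> animals m \<Longrightarrow>
      \<exists>g\<in>carrier G. \<exists>a\<in>cluster F1 \<one>. \<exists>Q. animal a Q \<and> card Q \<le> k \<and>
        cluster Q a \<inter> (\<lambda>x. x \<otimes> g) ` cluster F2 \<one> \<noteq> {} \<and>
        card (cluster F1 \<one> \<inter> (\<lambda>x. x \<otimes> g) ` cluster F2 \<one>) \<le> t \<and>
        card (cluster F1 \<one> \<union> cluster Q a \<union> (\<lambda>x. x \<otimes> g) ` cluster F2 \<one>) \<in> J"
    and J: "finite J" "\<And>j. j \<in> J \<Longrightarrow> j \<le> L"
  shows "p ^ k * (1 - p) ^ (card S * (2 * k + 1)) * (animal_sum p n * animal_sum p m) \<le>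
    real (((card S * L + 1) ^ (card S * t + k))\<^sup>2 * L) * (\<Sum>j\<in>J. animal_sum p j)"
proof -
  let ?tr = "\<lambda>g. (\<lambda>x. x \<otimes> g)"
  let ?X = "animals n \<times> animals m"
  let ?P = "\<lambda>F1 F2 g a Q. g \<in> carrier G \<and> a \<in> cluster F1 \<one> \<and> animal a Q \<and> card Q \<le> k \<and>
        cluster Q a \<inter> ?tr g ` cluster F2 \<one> \<noteq> {} \<and>
        card (cluster F1 \<one> \<inter> ?tr g ` cluster F2 \<one>) \<le> t \<and>
        card (cluster F1 \<one> \<union> cluster Q a \<union> ?tr g ` cluster F2 \<one>) \<in> J"
  define h where "h x = (SOME y. ?P (fst x) (snd x) (fst y) (fst (snd y)) (snd (snd y)))" for x
  have h: "?P (fst x) (snd x) (fst (h x)) (fst (snd (h x))) (snd (snd (h x)))" if x: "x \<in> ?X" for x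
  proof -
    obtain g a Q where "?P (fst x) (snd x) g a Q" using glue[of "fst x" "snd x"] x unfolding mem_Times_iff by blast
    then have "\<exists>y. ?P (fst x) (snd x) (fst y) (fst (snd y)) (snd (snd y))"
      by (intro exI[of _ "(g, a, Q)"]) simp
    then show ?thesis unfolding h_def by (rule someI_ex)
  qed
  define gg where "gg x = fst (h x)" for x
  define Q where "Q x = snd (snd (h x))" for x
  define aa where "aa x = fst (snd (h x))" for x
  define A where "A x = cluster (fst x) \<one>" for x :: "'a set set \<times> 'a set set"
  define H where "H x = (`) (?tr (gg x)) ` snd x" for x
  define B where "B x = cluster (H x) (gg x)" for x
  define F' where "F' x = fst x \<union> Q x \<union> H x" for x
  define D1 where "D1 x = {e \<in> F' x - fst x. e \<inter> A x \<noteq> {}}" for x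
  define D2 where "D2 x = {e \<in> F' x - H x. e \<inter> B x \<noteq> {}}" for x
  \<comment> \<open>the merged animal together with the information that recovers the pair\<close>
  define \<Phi> where "\<Phi> x = (F' x, D1 x, D2 x, gg x)" for x
  let ?s = "card S * t + k"
  define Sub where "Sub F = {D. D \<subseteq> F \<and> card D \<le> ?s}" for F :: "'a set set"
  define Z where "Z F = Sub F \<times> Sub F \<times> cluster F \<one>" for F
  let ?Y = "\<Union>j\<in>J. animals j"
  have x: "animal \<one> (fst x)" "animal \<one> (snd x)" "gg x \<in> carrier G" "aa x \<in> A x" "animal (aa x) (Q x)"
    "card (Q x) \<le> k" "animal (gg x) (H x)" "B x = ?tr (gg x) ` cluster (snd x) \<one>"
    "cluster (Q x) (aa x) \<inter> B x \<noteq> {}" "card (A x \<inter> B x) \<le> t"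
    "card (A x \<union> cluster (Q x) (aa x) \<union> B x) \<in> J" if "x \<in> ?X" for x
  proof -
    show "animal \<one> (fst x)" and 2: "animal \<one> (snd x)" using that unfolding animals_def by auto
    show 3: "gg x \<in> carrier G" using h[OF that] unfolding gg_def by blast
    show "animal (gg x) (H x)" and 4: "B x = ?tr (gg x) ` cluster (snd x) \<one>"
      unfolding B_def H_def using animal_translate[OF 3 2] by auto
    show "aa x \<in> A x" "animal (aa x) (Q x)" "card (Q x) \<le> k"
      "cluster (Q x) (aa x) \<inter> B x \<noteq> {}" "card (A x \<inter> B x) \<le> t"
      "card (A x \<union> cluster (Q x) (aa x) \<union> B x) \<in> J"
      unfolding 4 using h[OF that] unfolding gg_def Q_def aa_def A_def by blast+
  qed
  have F': "animal \<one> (F' x)" "cluster (F' x) \<one> = A x \<union> cluster (Q x) (aa x) \<union> B x" if "x \<in> ?X" for x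
  proof -
    note x = x[OF that]
    have a: "aa x \<in> carrier G" "aa x \<in> cluster (Q x) (aa x)"
      using x(4) cluster_carrier cluster_root unfolding A_def by blast+
    have 1: "animal \<one> (fst x \<union> Q x)" "cluster (fst x \<union> Q x) \<one> = A x \<union> cluster (Q x) (aa x)"
      using animal_Un[OF x(1,5) one_closed a(1)] a x(4) unfolding A_def by blast+
    show "animal \<one> (F' x)" "cluster (F' x) \<one> = A x \<union> cluster (Q x) (aa x) \<union> B x"
      using animal_Un[OF 1(1) x(7) one_closed x(3)] 1(2) x(9) unfolding F'_def B_def by blast+
  qed
  have F'Y: "F' x \<in> ?Y" if "x \<in> ?X" for x
    using F'[OF that] x(11)[OF that] unfolding animals_def by auto
  have D: "D1 x \<in> Sub (F' x)" "D2 x \<in> Sub (F' x)" if "x \<in> ?X" for x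
  proof -
    note x = x[OF that]
    have H: "H x \<subseteq> edges" "\<Union> (H x) \<subseteq> B x" and F: "fst x \<subseteq> edges" "\<Union> (fst x) \<subseteq> A x" and Q: "finite (Q x)"
      using x(1,7,5) unfolding animal_def A_def B_def by auto
    have "card (D1 x) \<le> card S * card (A x \<inter> B x) + card (Q x)"
      using card_touching_shared_le[OF x(1) H(2,1) Q] unfolding D1_def F'_def A_def .
    moreover have "card (D2 x) \<le> card S * card (B x \<inter> A x) + card (Q x)"
      using card_touching_shared_le[OF x(7) F(2,1) Q] unfolding D2_def F'_def B_def
      by (simp add: Un_ac)
    moreover have "card S * card (A x \<inter> B x) + card (Q x) \<le> ?s"
      using x(6,10) by (intro add_mono mult_le_mono2)
    ultimately have "card (D1 x) \<le> ?s" "card (D2 x) \<le> ?s" by (simp_all add: Int_commute)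
    then show "D1 x \<in> Sub (F' x)" "D2 x \<in> Sub (F' x)"
      unfolding Sub_def by (auto simp: D1_def D2_def)
  qed
  have recover: "touching_part (F' x - D1 x) \<one> = fst x" "touching_part (F' x - D2 x) (gg x) = H x"
    if "x \<in> ?X" for x
  proof -
    note x = x[OF that]
    have F'edges: "F' x \<subseteq> edges" using F'(1)[OF that] unfolding animal_def by blast
    show "touching_part (F' x - D1 x) \<one> = fst x"
      using animal_recover[OF x(1) one_closed _ F'edges] unfolding D1_def A_def F'_def by blast
    show "touching_part (F' x - D2 x) (gg x) = H x"
      using animal_recover[OF x(7) x(3) _ F'edges] unfolding D2_def B_def F'_def by blast
  qed
  have inj: "inj_on \<Phi> ?X"
  proof (rule inj_onI)
    fix u v assume uv: "u \<in> ?X" "v \<in> ?X" "\<Phi> u = \<Phi> v"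
    then have eqs: "F' u = F' v" "D1 u = D1 v" "D2 u = D2 v" "gg u = gg v" unfolding \<Phi>_def by auto
    have 1: "fst u = fst v" using recover(1)[OF uv(1)] recover(1)[OF uv(2)] eqs by simp
    have "H u = H v" using recover(2)[OF uv(1)] recover(2)[OF uv(2)] eqs by simp
    then have "(`) (?tr (gg u)) ` snd u = (`) (?tr (gg u)) ` snd v" unfolding H_def eqs .
    moreover have "snd u \<subseteq> Pow (carrier G)" "snd v \<subseteq> Pow (carrier G)"
      using x(2)[OF uv(1)] x(2)[OF uv(2)] edge_carrier unfolding animal_def by blast+
    ultimately have "snd u = snd v"
      using inj_on_image_eq_iff[OF translate_inj_sets[OF x(3)[OF uv(1)]]] by simp
    then show "u = v" using 1 by (simp add: prod_eq_iff)
  qed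
  have maps: "\<Phi> x \<in> Sigma ?Y Z" if "x \<in> ?X" for x
  proof -
    have "gg x = \<one> \<otimes> gg x" using x(3)[OF that] by simp
    then have "gg x \<in> B x" unfolding x(8)[OF that] using cluster_root[OF one_closed] by blast
    then have "gg x \<in> cluster (F' x) \<one>" unfolding F'(2)[OF that] by blast
    then show ?thesis unfolding \<Phi>_def Z_def using F'Y[OF that] D[OF that] by blast
  qed
  have Zb: "finite (Z F) \<and> card (Z F) \<le> ((card S * L + 1) ^ ?s)\<^sup>2 * L" if FY: "F \<in> ?Y" for F
  proof -
    have F: "animal \<one> F" "card (cluster F \<one>) \<le> L" using FY J(2) unfolding animals_def by auto
    have finF: "finite F" using F unfolding animal_def by blast
    have "card F \<le> card S * L" using animal_card_le[OF F(1)] F(2) mult_le_mono2 le_trans by blast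
    then have "(card F + 1) ^ ?s \<le> (card S * L + 1) ^ ?s" by (intro power_mono) auto
    then have Sub: "card (Sub F) \<le> (card S * L + 1) ^ ?s"
      using card_bounded_subsets[OF finF, of ?s] unfolding Sub_def by linarith
    have "finite (Sub F)" unfolding Sub_def using finF by auto
    moreover have "card (Z F) = card (Sub F) * card (Sub F) * card (cluster F \<one>)"
      unfolding Z_def by (simp add: card_cartesian_product)
    moreover have "\<dots> \<le> (card S * L + 1) ^ ?s * (card S * L + 1) ^ ?s * L"
      using Sub F(2) by (intro mult_le_mono)
    ultimately show ?thesis using animal_finite_cluster(1)[OF F(1)] unfolding Z_def
      by (simp add: power2_eq_square)
  qed
  define c where "c = p ^ k * (1 - p) ^ (card S * (2 * k + 1))"
  have c0: "0 \<le> c" using p unfolding c_def by simp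
  have w: "c * (weight p (fst x) \<one> * weight p (snd x) \<one>) \<le> weight p (fst (\<Phi> x)) \<one>"
    if "x \<in> ?X" for x
  proof -
    note x = x[OF that]
    have "weight p (fst x) \<one> * weight p (snd x) \<one> \<le> weight p (fst x) \<one> * weight p (H x) (gg x)"
      using weight_translate_ge[OF p x(3) x(2)] weight_nonneg[OF p] unfolding H_def
      by (intro mult_left_mono) auto
    then have "c * (weight p (fst x) \<one> * weight p (snd x) \<one>) \<le>
        c * (weight p (fst x) \<one> * weight p (H x) (gg x))" using c0 by (rule mult_left_mono)
    also have "\<dots> \<le> weight p (F' x) \<one>"
      using weight_Un_ge[OF p x(1) x(7) x(5,6)] F'(2)[OF that] unfolding c_def F'_def A_def B_def by simp
    finally show ?thesis unfolding \<Phi>_def by simp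
  qed
  have "c * (\<Sum>x\<in>?X. weight p (fst x) \<one> * weight p (snd x) \<one>) \<le>
      real (((card S * L + 1) ^ ?s)\<^sup>2 * L) * (\<Sum>F\<in>?Y. weight p F \<one>)"
    by (rule weighted_injection_bound[where wX = "\<lambda>x. weight p (fst x) \<one> * weight p (snd x) \<one>"
          and wY = "\<lambda>F. weight p F \<one>", OF _ _ inj maps Zb w weight_nonneg[OF p]])
       (use finite_animals J in auto)
  also have "(\<Sum>x\<in>?X. weight p (fst x) \<one> * weight p (snd x) \<one>) = animal_sum p n * animal_sum p m"
    unfolding animal_sum_def by (simp add: sum_product sum.cartesian_product case_prod_unfold)
  also have "(\<Sum>F\<in>?Y. weight p F \<one>) = (\<Sum>j\<in>J. animal_sum p j)"
    unfolding animal_sum_def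
    by (rule sum.UNION_disjoint) (use finite_animals J in \<open>auto simp: animals_def\<close>)
  finally show ?thesis unfolding c_def .
qed

end

section \<open>Changing the size by one\<close>

context cayley_graph
begin

text \<open>
  As the group is infinite and the Cayley graph connected, every finite animal can grow.
\<close>

lemma vertex_leaving:
  assumes "finite A" "\<one> \<in> A" shows "\<exists>a\<in>A. \<exists>s\<in>S. s \<otimes> a \<notin> A"
proof (rule ccontr)
  assume "\<not> ?thesis"
  then have "carrier G \<subseteq> A" using assms(2) by (intro S_invariant_eq_carrier) auto
  then show False using assms(1) infinite_carrier finite_subset by blast
qed

lemma card_S_pos: "1 \<le> card S"
  using vertex_leaving[of "{\<one>}"] finite_S by (auto simp: Suc_le_eq card_gt_0_iff)

lemma animal_sum_1_pos:
  assumes "0 < p" "p < 1" shows "0 < animal_sum p 1"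
proof -
  have "{} \<in> animals 1" unfolding animals_def using animal_empty[of \<one>] by simp
  then show ?thesis unfolding animal_sum_def
    using weight_pos[OF assms] finite_animals by (intro sum_pos2[of _ "{}"]) (auto simp: less_imp_le)
qed

text \<open>
  Merging with the one-vertex animal, placed at a neighbour outside of the cluster, adds exactly one vertex.
\<close>

lemma step_up:
  assumes p: "0 \<le> p" "p \<le> 1"
  shows "p * (1 - p) ^ (card S * 3) * (animal_sum p n * animal_sum p 1) \<le>
    real ((card S * (n + 1) + 1)\<^sup>2 * (n + 1)) * animal_sum p (n + 1)"
proof -
  have "p ^ 1 * (1 - p) ^ (card S * (2 * 1 + 1)) * (animal_sum p n * animal_sum p 1) \<le>
    real (((card S * (n + 1) + 1) ^ (card S * 0 + 1))\<^sup>2 * (n + 1)) * (\<Sum>j\<in>{n + 1}. animal_sum p j)"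
  proof (rule merge_bound[OF p])
    fix F1 F2 assume F1: "F1 \<in> animals n" and F2: "F2 \<in> animals 1"
    have A: "animal \<one> F1" "card (cluster F1 \<one>) = n" using F1 unfolding animals_def by auto
    have finA: "finite (cluster F1 \<one>)" using animal_finite_cluster A by blast
    have B: "cluster F2 \<one> = {\<one>}"
      using F2 cluster_root[OF one_closed, of F2] unfolding animals_def by (auto simp: card_1_singleton_iff)
    obtain a s where as: "a \<in> cluster F1 \<one>" "s \<in> S" "s \<otimes> a \<notin> cluster F1 \<one>"
      using vertex_leaving[OF finA cluster_root[OF one_closed]] by blast
    have ac: "a \<in> carrier G" using as cluster_carrier by blast
    have g: "s \<otimes> a \<in> carrier G" using ac as by simp
    have Bg: "(\<lambda>x. x \<otimes> (s \<otimes> a)) ` cluster F2 \<one> = {s \<otimes> a}" unfolding B using g by simp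
    note e = animal_edge[OF ac as(2)]
    have U: "cluster F1 \<one> \<union> cluster {{a, s \<otimes> a}} a \<union> {s \<otimes> a} = insert (s \<otimes> a) (cluster F1 \<one>)"
      unfolding e(2) using as(1) by auto
    have "card (cluster F1 \<one> \<union> cluster {{a, s \<otimes> a}} a \<union> {s \<otimes> a}) \<in> {n + 1}"
      unfolding U using finA as(3) A(2) by simp
    moreover have "cluster F1 \<one> \<inter> {s \<otimes> a} = {}" using as(3) by blast
    moreover have "cluster {{a, s \<otimes> a}} a \<inter> {s \<otimes> a} \<noteq> {}" unfolding e(2) by blast
    ultimately show "\<exists>g\<in>carrier G. \<exists>a\<in>cluster F1 \<one>. \<exists>Q. animal a Q \<and> card Q \<le> 1 \<and>
        cluster Q a \<inter> (\<lambda>x. x \<otimes> g) ` cluster F2 \<one> \<noteq> {} \<and>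
        card (cluster F1 \<one> \<inter> (\<lambda>x. x \<otimes> g) ` cluster F2 \<one>) \<le> 0 \<and>
        card (cluster F1 \<one> \<union> cluster Q a \<union> (\<lambda>x. x \<otimes> g) ` cluster F2 \<one>) \<in> {n + 1}"
      using g as(1) e(1)
      by (intro bexI[of _ "s \<otimes> a"] bexI[of _ a] exI[of _ "{{a, s \<otimes> a}}"]) (simp_all add: Bg)
  qed auto
  then show ?thesis by simp
qed

lemma animal_sum_pos:
  assumes p: "0 < p" "p < 1" shows "0 < animal_sum p (Suc n)"
proof (induction n)
  case 0
  then show ?case using animal_sum_1_pos[OF p] by simp
next
  case (Suc n)
  have "0 < p * (1 - p) ^ (card S * 3) * (animal_sum p (Suc n) * animal_sum p 1)"
    using Suc animal_sum_1_pos[OF p] p by simp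
  also have "\<dots> \<le> real ((card S * (Suc n + 1) + 1)\<^sup>2 * (Suc n + 1)) * animal_sum p (Suc n + 1)"
    using p by (intro step_up) auto
  finally have "0 < animal_sum p (Suc n + 1)" by (rule zero_less_mult_pos) (unfold of_nat_0_less_iff, simp)
  then show ?case by simp
qed

text \<open>
  Remove a vertex \<open>v\<close> as in \<open>animal_remove_vertex\<close> and store the edges of the animal at \<open>v\<close>. There are at
  most \<open>card S\<close> of them, and they touch the halo of the smaller animal, which leaves only polynomially
  many possibilities.
\<close>

lemma step_down:
  assumes p: "0 \<le> p" "p \<le> 1" and n: "n \<ge> 1"
  shows "(1 - p) ^ card S * animal_sum p (n + 1) \<le>
    real ((card S * ((card S + 1) * n) + 1) ^ card S) * animal_sum p n"
proof -
  define v where "v F = (SOME v. v \<in> cluster F \<one> \<and> animal \<one> (F - touch {v}) \<and>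
      cluster (F - touch {v}) \<one> = cluster F \<one> - {v} \<and>
      (\<exists>u \<in> cluster (F - touch {v}) \<one>. \<exists>s\<in>S. v = s \<otimes> u))" for F
  have v: "v F \<in> cluster F \<one> \<and> animal \<one> (F - touch {v F}) \<and>
      cluster (F - touch {v F}) \<one> = cluster F \<one> - {v F} \<and>
      (\<exists>u \<in> cluster (F - touch {v F}) \<one>. \<exists>s\<in>S. v F = s \<otimes> u)" if "F \<in> animals (n + 1)" for F
    unfolding v_def
    by (rule someI_ex) (use animal_remove_vertex[of F] that n in \<open>auto simp: animals_def Bex_def\<close>)
  define Z where "Z F = {D. D \<subseteq> touch (halo (cluster F \<one>)) \<and> card D \<le> card S}" for F
  define \<Phi> where "\<Phi> F = (F - touch {v F}, F \<inter> touch {v F})" for F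
  have "(1 - p) ^ card S * (\<Sum>F\<in>animals (n + 1). weight p F \<one>) \<le>
      real ((card S * ((card S + 1) * n) + 1) ^ card S) * (\<Sum>F\<in>animals n. weight p F \<one>)"
  proof (rule weighted_injection_bound[where \<Phi> = \<Phi> and Z = Z])
    show "inj_on \<Phi> (animals (n + 1))"
      by (rule inj_onI) (auto simp: \<Phi>_def)
  next
    fix F assume Fn: "F \<in> animals (n + 1)"
    then have F: "animal \<one> F" "card (cluster F \<one>) = n + 1" unfolding animals_def by auto
    have finF: "finite (cluster F \<one>)" using animal_finite_cluster F by blast
    have c: "cluster (F - touch {v F}) \<one> = cluster F \<one> - {v F}" using v[OF Fn] by blast
    have "F - touch {v F} \<in> animals n"
      unfolding animals_def using v[OF Fn] F finF by simp
    moreover have "v F \<in> halo (cluster (F - touch {v F}) \<one>)"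
      using v[OF Fn] unfolding halo_def by fastforce
    then have "F \<inter> touch {v F} \<subseteq> touch (halo (cluster (F - touch {v F}) \<one>))"
      unfolding touch_def by blast
    moreover have "card (F \<inter> touch {v F}) \<le> card S"
      using card_mono[OF finite_touch[of "{v F}"], of "F \<inter> touch {v F}"] card_touch[of "{v F}"] by simp
    ultimately show "\<Phi> F \<in> Sigma (animals n) Z" unfolding \<Phi>_def Z_def by blast
    have "card (touch (cluster F \<one> - {v F}) - (F - touch {v F})) \<le> card ((touch (cluster F \<one>) - F) \<union> touch {v F})"
      using finite_touch[OF finF] finite_touch[of "{v F}"] by (intro card_mono) (auto simp: touch_def)
    also have "\<dots> \<le> card (touch (cluster F \<one>) - F) + card S"
      using card_Un_le[of "touch (cluster F \<one>) - F" "touch {v F}"] card_touch[of "{v F}"] by simp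
    finally have 1: "card (touch (cluster F \<one> - {v F}) - (F - touch {v F})) \<le> card (touch (cluster F \<one>) - F) + card S" .
    have 2: "card (F - touch {v F}) \<le> card F" using F by (intro card_mono) (auto simp: animal_def)
    have "(1 - p) ^ card S * weight p F \<one> = p ^ card F * (1 - p) ^ (card (touch (cluster F \<one>) - F) + card S)"
      unfolding weight_def by (simp add: power_add)
    also have "\<dots> \<le> weight p (F - touch {v F}) \<one>"
      unfolding weight_def c using p 1 2 by (intro mult_mono power_decreasing) auto
    finally show "(1 - p) ^ card S * weight p F \<one> \<le> weight p (fst (\<Phi> F)) \<one>" unfolding \<Phi>_def by simp
  next
    fix F assume "F \<in> animals n"
    then have F: "finite (cluster F \<one>)" "card (cluster F \<one>) = n"
      using animal_finite_cluster unfolding animals_def by auto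
    let ?T = "touch (halo (cluster F \<one>))"
    have finT: "finite ?T" using F finite_halo finite_touch by blast
    have "card ?T \<le> card S * card (halo (cluster F \<one>))" using F finite_halo card_touch by blast
    also have "\<dots> \<le> card S * ((card S + 1) * n)" using card_halo[OF F(1)] F(2) by (intro mult_le_mono2) simp
    finally have "(card ?T + 1) ^ card S \<le> (card S * ((card S + 1) * n) + 1) ^ card S"
      by (intro power_mono) auto
    then have "card (Z F) \<le> (card S * ((card S + 1) * n) + 1) ^ card S"
      using card_bounded_subsets[OF finT, of "card S"] unfolding Z_def by linarith
    then show "finite (Z F) \<and> card (Z F) \<le> (card S * ((card S + 1) * n) + 1) ^ card S"
      unfolding Z_def using finT by auto
  qed (use finite_animals weight_nonneg[OF p] in auto)
  then show ?thesis unfolding animal_sum_def .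
qed

end

section \<open>Almost subadditive sequences\<close>

text \<open>
  Write \<open>c * N + r\<close> as a sum of \<open>c - 1\<close> blocks of length \<open>N\<close> and one of length \<open>N + r\<close>, and halve the number of
  blocks repeatedly. Putting the longer block into the half with fewer blocks keeps the two parts
  within a factor of two of each other.
\<close>

lemma balanced_subadditive_block:
  fixes g :: "nat \<Rightarrow> real"
  assumes sub: "\<And>n m. n \<ge> 1 \<Longrightarrow> m \<ge> 1 \<Longrightarrow> n \<le> 2 * m \<Longrightarrow> m \<le> 2 * n \<Longrightarrow> g (n + m) \<le> g n + g m"
    and N: "N \<ge> 1" and c: "c \<ge> 1" and r: "r < N"
  shows "g (c * N + r) \<le> (real c - 1) * g N + g (N + r)"
  using c r
proof (induction c arbitrary: r rule: less_induct)
  case (less c)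
  show ?case
  proof (cases "c = 1")
    case True
    then show ?thesis by simp
  next
    case False
    define a where "a = c div 2"
    define b where "b = c - a"
    have ab: "a \<ge> 1" "b \<ge> 1" "a < c" "b < c" "a \<le> b" "b \<le> 2 * a" "c = a + b"
      using False less.prems unfolding a_def b_def by auto
    have "a * N + r \<le> (a + 1) * N" using less.prems by simp
    also have "\<dots> \<le> (2 * b) * N" using ab by (intro mult_le_mono1) linarith
    finally have 1: "a * N + r \<le> 2 * (b * N)" by (simp add: mult.assoc)
    have "b * N \<le> (2 * a) * N" using ab by (intro mult_le_mono1)
    also have "\<dots> \<le> 2 * (a * N + r)" by (simp add: algebra_simps)
    finally have 2: "b * N \<le> 2 * (a * N + r)" .
    have 3: "a * N + r \<ge> 1" "b * N \<ge> 1" using ab N by (auto simp: Suc_le_eq)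
    have "g (c * N + r) = g ((a * N + r) + b * N)" using ab(7) by (simp add: algebra_simps)
    also have "\<dots> \<le> g (a * N + r) + g (b * N)" by (rule sub[OF 3 1 2])
    also have "g (a * N + r) \<le> (real a - 1) * g N + g (N + r)"
      using less.IH[of a r] ab less.prems by simp
    also have "g (b * N) \<le> (real b - 1) * g N + g N"
      using less.IH[of b 0] ab N by simp
    finally show ?thesis using ab(7) by (simp add: algebra_simps)
  qed
qed

text \<open>
  The lemma of de Bruijn and Erdos: Fekete's lemma needs subadditivity only for summands of comparable size.
\<close>

lemma balanced_subadditive_convergent:
  fixes g :: "nat \<Rightarrow> real"
  assumes sub: "\<And>n m. n \<ge> 1 \<Longrightarrow> m \<ge> 1 \<Longrightarrow> n \<le> 2 * m \<Longrightarrow> m \<le> 2 * n \<Longrightarrow> g (n + m) \<le> g n + g m"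
    and nonneg: "\<And>n. n \<ge> 1 \<Longrightarrow> 0 \<le> g n"
  shows "convergent (\<lambda>n. g n / real n)"
proof -
  define A where "A = (\<lambda>n. g n / real n) ` {1..}"
  have bdd: "bdd_below A" unfolding A_def by (rule bdd_belowI[of _ 0]) (auto simp: nonneg)
  have neA: "A \<noteq> {}" unfolding A_def by auto
  have "(\<lambda>n. g n / real n) \<longlonglongrightarrow> Inf A"
  proof (rule LIMSEQ_I)
    fix e :: real assume e: "0 < e"
    then obtain N where N: "N \<ge> 1" "g N / real N < Inf A + e / 2"
      using cInf_lessD[OF neA, of "Inf A + e / 2"] unfolding A_def by auto
    \<comment> \<open>a bound for the cost of the one irregular block, independent of \<open>n\<close>\<close>
    define M where "M = (\<Sum>r<N. g (N + r))"
    obtain n0 :: nat where n0: "2 * M / e < real n0" using reals_Archimedean2 by blast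
    show "\<exists>no. \<forall>n\<ge>no. norm (g n / real n - Inf A) < e"
    proof (intro exI allI impI)
      fix n assume n: "n \<ge> max N n0"
      define c where "c = n div N"
      define r where "r = n mod N"
      have rN: "r < N" using N unfolding r_def by simp
      have c1: "c \<ge> 1" using n N unfolding c_def by (simp add: div_greater_zero_iff Suc_le_eq)
      have ncr: "n = c * N + r" unfolding c_def r_def by simp
      have n1: "n \<ge> 1" using n N by simp
      have gM: "g (N + r) \<le> M" unfolding M_def
        by (rule member_le_sum[of r "{..<N}" "\<lambda>r. g (N + r)"]) (use rN N nonneg in auto)
      have "g n \<le> (real c - 1) * g N + g (N + r)"
        using balanced_subadditive_block[of g, OF sub N(1) c1 rN] ncr by simp
      also have "\<dots> \<le> real c * g N + M" using gM nonneg[OF N(1)] by (simp add: algebra_simps)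
      also have "real c * g N = (real c * real N) * (g N / real N)" using N by simp
      also have "\<dots> \<le> real n * (g N / real N)"
        using N nonneg[OF N(1)] ncr by (intro mult_right_mono) (auto simp flip: of_nat_mult)
      finally have "g n / real n \<le> (real n * (g N / real N) + M) / real n"
        by (simp add: divide_right_mono)
      also have "\<dots> = g N / real N + M / real n" using n1 by (simp add: add_divide_distrib)
      also have "M / real n < e / 2"
      proof -
        have "2 * M / e < real n" using n0 n by simp
        then show ?thesis using e n1 by (simp add: field_simps)
      qed
      finally have up: "g n / real n < Inf A + e" using N(2) by linarith
      have "Inf A \<le> g n / real n" using n1 bdd unfolding A_def by (intro cInf_lower) auto
      then show "norm (g n / real n - Inf A) < e" using up by simp
    qed
  qed
  then show ?thesis by (rule convergentI)
qed

text \<open>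
  For summands of comparable size, \<open>n powr \<gamma> + m powr \<gamma>\<close> exceeds \<open>(n + m) powr \<gamma>\<close> by a constant factor \<open>\<beta> > 1\<close>, so
  adding a suitable multiple of \<open>n powr \<gamma>\<close> to \<open>f\<close> absorbs the error term. The added term vanishes after
  division by \<open>n\<close>.
\<close>

lemma almost_subadditive_convergent:
  fixes f :: "nat \<Rightarrow> real"
  assumes sub: "\<And>n m. n \<ge> 1 \<Longrightarrow> m \<ge> 1 \<Longrightarrow> f (n + m) \<le> f n + f m + K * real (n + m) powr \<gamma>"
    and nonneg: "\<And>n. n \<ge> 1 \<Longrightarrow> 0 \<le> f n"
    and K: "0 \<le> K" and \<gamma>: "\<gamma> < 1"
  shows "convergent (\<lambda>n. f n / real n)"
proof -
  \<comment> \<open>the smaller of two comparable summands is at least a third of the sum, so the larger is at most two thirds\<close>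
  define \<beta> :: real where "\<beta> = (2/3) powr (\<gamma> - 1)"
  have "(2/3 :: real) powr (\<gamma> - 1) > (2/3) powr 0"
    using \<gamma> by (intro powr_less_mono') auto
  then have \<beta>: "\<beta> > 1" unfolding \<beta>_def by simp
  define D where "D = K / (\<beta> - 1)"
  have D: "D \<ge> 0" "K + D = D * \<beta>" using \<beta> K unfolding D_def by (auto simp: field_simps)
  define g where "g n = f n + D * real n powr \<gamma>" for n
  have half: "real n * (\<beta> * real (n + m) powr (\<gamma> - 1)) \<le> real n powr \<gamma>"
    if "n \<ge> 1" "m \<ge> 1" "n \<le> 2 * m" for n m :: nat
  proof -
    have "\<beta> * real (n + m) powr (\<gamma> - 1) = (2/3 * real (n + m)) powr (\<gamma> - 1)"
      unfolding \<beta>_def by (subst powr_mult) auto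
    also have "\<dots> \<le> real n powr (\<gamma> - 1)"
      using that \<gamma> by (intro powr_mono2') auto
    finally have "real n * (\<beta> * real (n + m) powr (\<gamma> - 1)) \<le> real n * real n powr (\<gamma> - 1)"
      by (rule mult_left_mono) simp
    also have "\<dots> = real n powr \<gamma>" using that by (simp add: powr_mult_base)
    finally show ?thesis .
  qed
  have "convergent (\<lambda>n. g n / real n)"
  proof (rule balanced_subadditive_convergent)
    fix n m :: nat assume nm: "n \<ge> 1" "m \<ge> 1" "n \<le> 2 * m" "m \<le> 2 * n"
    have "\<beta> * real (n + m) powr \<gamma> = \<beta> * (real (n + m) * real (n + m) powr (\<gamma> - 1))"
      using nm by (subst powr_mult_base) auto
    also have "\<dots> = real n * (\<beta> * real (n + m) powr (\<gamma> - 1)) + real m * (\<beta> * real (m + n) powr (\<gamma> - 1))"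
      by (simp add: algebra_simps)
    also have "\<dots> \<le> real n powr \<gamma> + real m powr \<gamma>"
      using half[of n m] half[of m n] nm by linarith
    finally have "D * (\<beta> * real (n + m) powr \<gamma>) \<le> D * (real n powr \<gamma> + real m powr \<gamma>)"
      using D(1) by (rule mult_left_mono)
    moreover have "g (n + m) \<le> f n + f m + (K + D) * real (n + m) powr \<gamma>"
      using sub[OF nm(1,2)] unfolding g_def by (simp add: algebra_simps)
    ultimately show "g (n + m) \<le> g n + g m" unfolding g_def D(2) by (simp add: algebra_simps)
  next
    fix n :: nat assume "n \<ge> 1"
    then show "0 \<le> g n" unfolding g_def using nonneg D by simp
  qed
  moreover have "(\<lambda>n. D * real n powr (\<gamma> - 1)) \<longlonglongrightarrow> D * 0"
    using \<gamma> by (intro tendsto_mult tendsto_const tendsto_neg_powr filterlim_real_sequentially) auto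
  then have "convergent (\<lambda>n. D * real n powr (\<gamma> - 1))" by (rule convergentI)
  ultimately have "convergent (\<lambda>n. g n / real n - D * real n powr (\<gamma> - 1))"
    by (rule convergent_diff)
  moreover have "g n / real n - D * real n powr (\<gamma> - 1) = f n / real n" for n
    unfolding g_def by (cases "n = 0") (auto simp: add_divide_distrib powr_diff)
  ultimately show ?thesis by simp
qed

section \<open>Existence of the limit\<close>

lemma ln_le_of_weighted_le:
  fixes x y q M W :: real
  assumes "q * x \<le> M * y" "0 < q" "0 < x" "0 < y" "0 < M" "M \<le> W"
  shows "ln x \<le> ln y + ln W - ln q"
proof -
  have "q * x \<le> W * y" using assms by (meson less_imp_le mult_right_mono order_trans)
  then have "ln (q * x) \<le> ln (W * y)" using assms by (intro ln_mono) auto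
  then show ?thesis using assms by (simp add: ln_mult)
qed

lemma abs_diff_le_steps:
  fixes f :: "nat \<Rightarrow> real"
  assumes step: "\<And>i. a \<le> i \<Longrightarrow> i < b \<Longrightarrow> \<bar>f (Suc i) - f i\<bar> \<le> B"
    and ij: "a \<le> i" "i \<le> j" "j \<le> b"
  shows "\<bar>f j - f i\<bar> \<le> real (j - i) * B"
  using ij(2,3)
proof (induction j rule: dec_induct)
  case (step j)
  then have "\<bar>f (Suc j) - f j\<bar> \<le> B" using assms ij(1) by simp
  moreover have "real (Suc j - i) * B = real (j - i) * B + B" using step by (simp add: Suc_diff_le algebra_simps)
  ultimately show ?case using step by linarith
qed simp

context cayley_graph
begin

text \<open>
  Both \<open>step_up\<close> and \<open>step_down\<close> cost a factor polynomial in the size.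
\<close>

lemma log_step_bound:
  assumes p: "0 < p" "p < 1"
  shows "\<exists>c\<ge>0. \<forall>n\<ge>1. \<bar>ln (animal_sum p (Suc n)) - ln (animal_sum p n)\<bar> \<le> c * (1 + ln (real n))"
proof -
  define d where "d = card S"
  define q1 where "q1 = p * (1 - p) ^ (d * 3) * animal_sum p 1"
  define q2 where "q2 = (1 - p) ^ d"
  define \<kappa>1 where "\<kappa>1 = real (2 * d + 2)"
  define \<kappa>2 where "\<kappa>2 = real (d * (d + 1) + 1)"
  have pos: "q1 > 0" "q2 > 0" "\<kappa>1 \<ge> 1" "\<kappa>2 \<ge> 1"
    using p animal_sum_1_pos[OF p] unfolding q1_def q2_def \<kappa>1_def \<kappa>2_def by auto
  define c1 where "c1 = \<bar>ln q1\<bar> + 3 * ln \<kappa>1 + 3"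
  define c2 where "c2 = \<bar>ln q2\<bar> + real d * ln \<kappa>2 + real d"
  have c: "c1 \<ge> 0" "c2 \<ge> 0" using pos unfolding c1_def c2_def by auto
  show ?thesis
  proof (intro exI[of _ "c1 + c2"] conjI allI impI)
    show "0 \<le> c1 + c2" using c by simp
  next
    fix n :: nat assume n: "1 \<le> n"
    define l where "l = ln (real n)"
    have l: "l \<ge> 0" using n unfolding l_def by simp
    have Sn: "0 < animal_sum p n" "0 < animal_sum p (Suc n)"
      using animal_sum_pos[OF p, of "n - 1"] animal_sum_pos[OF p, of n] n by auto
    have "(d * (n + 1) + 1)\<^sup>2 * (n + 1) \<le> ((2 * d + 2) * n)\<^sup>2 * ((2 * d + 2) * n)"
    proof (intro mult_le_mono power_mono)
      have "d \<le> d * n" using n by simp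
      moreover have "(2 * d + 2) * n = d * n + d * n + 2 * n" "d * (n + 1) + 1 = d * n + d + 1"
        by (simp_all add: algebra_simps)
      ultimately show "d * (n + 1) + 1 \<le> (2 * d + 2) * n" using n by linarith
      have "n + 1 \<le> 2 * n" using n by simp
      also have "\<dots> \<le> (2 * d + 2) * n" by (intro mult_le_mono1) simp
      finally show "n + 1 \<le> (2 * d + 2) * n" .
    qed simp
    then have "real ((d * (n + 1) + 1)\<^sup>2 * (n + 1)) \<le> real (((2 * d + 2) * n)\<^sup>2 * ((2 * d + 2) * n))"
      by (simp only: of_nat_le_iff)
    also have "\<dots> = (\<kappa>1 * real n) ^ 3" unfolding \<kappa>1_def by (simp add: power2_eq_square power3_eq_cube algebra_simps)
    finally have W1: "real ((d * (n + 1) + 1)\<^sup>2 * (n + 1)) \<le> (\<kappa>1 * real n) ^ 3" .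
    have "q1 * animal_sum p n \<le> real ((d * (n + 1) + 1)\<^sup>2 * (n + 1)) * animal_sum p (Suc n)"
      using step_up[of p n] p unfolding q1_def d_def by (simp add: algebra_simps)
    then have "ln (animal_sum p n) \<le> ln (animal_sum p (Suc n)) + ln ((\<kappa>1 * real n) ^ 3) - ln q1"
      by (rule ln_le_of_weighted_le[OF _ pos(1) Sn(1) Sn(2) _ W1]) (unfold of_nat_0_less_iff, simp)
    also have "ln ((\<kappa>1 * real n) ^ 3) = 3 * ln \<kappa>1 + 3 * l"
      using pos n unfolding l_def by (simp add: ln_realpow ln_mult)
    finally have up: "ln (animal_sum p n) - ln (animal_sum p (Suc n)) \<le> c1 + 3 * l"
      unfolding c1_def by linarith
    have "d * ((d + 1) * n) + 1 \<le> (d * (d + 1) + 1) * n" using n by (simp add: algebra_simps)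
    then have "real (d * ((d + 1) * n) + 1) \<le> \<kappa>2 * real n"
      unfolding \<kappa>2_def of_nat_mult[symmetric] by (simp only: of_nat_le_iff)
    then have "real (d * ((d + 1) * n) + 1) ^ d \<le> (\<kappa>2 * real n) ^ d" by (intro power_mono) auto
    then have W2: "real ((d * ((d + 1) * n) + 1) ^ d) \<le> (\<kappa>2 * real n) ^ d" by simp
    have "q2 * animal_sum p (Suc n) \<le> real ((d * ((d + 1) * n) + 1) ^ d) * animal_sum p n"
      using step_down[of p n] p n unfolding q2_def d_def by simp
    then have "ln (animal_sum p (Suc n)) \<le> ln (animal_sum p n) + ln ((\<kappa>2 * real n) ^ d) - ln q2"
      by (rule ln_le_of_weighted_le[OF _ pos(2) Sn(2) Sn(1) _ W2]) (unfold of_nat_0_less_iff, simp)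
    also have "ln ((\<kappa>2 * real n) ^ d) = real d * ln \<kappa>2 + real d * l"
      using pos n unfolding l_def by (simp add: ln_realpow ln_mult algebra_simps)
    finally have down: "ln (animal_sum p (Suc n)) - ln (animal_sum p n) \<le> c2 + real d * l"
      unfolding c2_def by linarith
    have "3 \<le> c1" "real d \<le> c2" using pos unfolding c1_def c2_def by auto
    then have "3 * l \<le> c1 * l" "real d * l \<le> c2 * l" "0 \<le> c1 * l" "0 \<le> c2 * l"
      using l c by (auto intro: mult_right_mono)
    moreover have "(c1 + c2) * (1 + l) = c1 + c2 + c1 * l + c2 * l" by (simp add: algebra_simps)
    ultimately show "\<bar>ln (animal_sum p (Suc n)) - ln (animal_sum p n)\<bar> \<le> (c1 + c2) * (1 + ln (real n))"
      using up down c unfolding l_def[symmetric] by linarith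
  qed
qed

text \<open>
  The union of \<open>A\<close>, the path and \<open>B g\<close> has at least \<open>n + m - k\<close> vertices because of the bound on the overlap, and
  at most \<open>n + m + (2 * k + 1)\<close> because of the bound on the path.
\<close>

lemma merge_near_sum:
  fixes n m :: nat
  assumes p: "0 < p" "p < 1"
    and C: "\<And>A B. A \<subseteq> carrier G \<Longrightarrow> finite A \<Longrightarrow> \<one> \<in> A \<Longrightarrow> card A \<le> n + m \<Longrightarrow>
      B \<subseteq> carrier G \<Longrightarrow> finite B \<Longrightarrow> \<one> \<in> B \<Longrightarrow> card B \<le> n + m \<Longrightarrow>
      \<exists>g\<in>carrier G. card (A \<inter> (\<lambda>x. x \<otimes> g) ` B) \<le> k \<and>
           (\<exists>a\<in>A. \<exists>b\<in>B. \<exists>h\<in>word_ball k. b \<otimes> g = h \<otimes> a)"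
  defines "L \<equiv> n + m + 2 * k + 1"
  shows "p ^ k * (1 - p) ^ (card S * (2 * k + 1)) * (animal_sum p n * animal_sum p m) \<le>
    real (((card S * L + 1) ^ (card S * k + k))\<^sup>2 * L) *
      (\<Sum>j | 1 \<le> j \<and> n + m \<le> j + k \<and> j \<le> L. animal_sum p j)"
proof (rule merge_bound)
  fix F1 F2 assume F12: "F1 \<in> animals n" "F2 \<in> animals m"
  define A where "A = cluster F1 \<one>"
  define B where "B = cluster F2 \<one>"
  have A: "A \<subseteq> carrier G" "finite A" "\<one> \<in> A" "card A = n"
    and B: "B \<subseteq> carrier G" "finite B" "\<one> \<in> B" "card B = m"
    using F12 animal_finite_cluster cluster_carrier cluster_root[OF one_closed]
    unfolding A_def B_def animals_def by auto
  obtain g a b h where g: "g \<in> carrier G" "card (A \<inter> (\<lambda>x. x \<otimes> g) ` B) \<le> k"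
    and h: "a \<in> A" "b \<in> B" "h \<in> word_ball k" "b \<otimes> g = h \<otimes> a"
    using C[OF A(1,2,3) _ B(1,2,3)] A(4) B(4) by auto
  define Bg where "Bg = (\<lambda>x. x \<otimes> g) ` B"
  have Bg: "finite Bg" "card Bg = m"
    unfolding Bg_def using B card_image[OF inj_on_subset[OF translate_inj[OF g(1)] B(1)]] by auto
  have "a \<in> carrier G" using h A by blast
  then obtain Q where Q: "animal a Q" "h \<otimes> a \<in> cluster Q a" "card Q \<le> k"
    using path_animal h(3) by blast
  define P where "P = cluster Q a"
  have P: "finite P" "card P \<le> 2 * k + 1"
    using animal_finite_cluster[OF Q(1)] Q(3) unfolding P_def by auto
  have "b \<otimes> g \<in> Bg" unfolding Bg_def using h(2) by blast
  then have meet: "P \<inter> Bg \<noteq> {}" using Q(2) h(4) unfolding P_def by auto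
  have "card (A \<union> P \<union> Bg) \<le> card A + card P + card Bg"
    using card_Un_le[of "A \<union> P" Bg] card_Un_le[of A P] by linarith
  then have up: "card (A \<union> P \<union> Bg) \<le> L" unfolding L_def using A(4) Bg(2) P(2) by linarith
  have "card A + card Bg = card (A \<union> Bg) + card (A \<inter> Bg)" using A(2) Bg(1) by (rule card_Un_Int)
  moreover have "card (A \<union> Bg) \<le> card (A \<union> P \<union> Bg)" using A(2) Bg(1) P(1) by (intro card_mono) auto
  ultimately have low: "n + m \<le> card (A \<union> P \<union> Bg) + k" using A(4) Bg(2) g(2) unfolding Bg_def by linarith
  have "card (A \<union> P \<union> Bg) \<noteq> 0" using A(2,3) Bg(1) P(1) by auto
  then have "card (A \<union> P \<union> Bg) \<in> {j. 1 \<le> j \<and> n + m \<le> j + k \<and> j \<le> L}" using up low by simp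
  then show "\<exists>g\<in>carrier G. \<exists>a\<in>cluster F1 \<one>. \<exists>Q. animal a Q \<and> card Q \<le> k \<and>
        cluster Q a \<inter> (\<lambda>x. x \<otimes> g) ` cluster F2 \<one> \<noteq> {} \<and>
        card (cluster F1 \<one> \<inter> (\<lambda>x. x \<otimes> g) ` cluster F2 \<one>) \<le> k \<and>
        card (cluster F1 \<one> \<union> cluster Q a \<union> (\<lambda>x. x \<otimes> g) ` cluster F2 \<one>) \<in>
          {j. 1 \<le> j \<and> n + m \<le> j + k \<and> j \<le> L}"
    using g h(1) Q(1,3) meet unfolding A_def B_def P_def Bg_def by blast
qed (use p in auto)

text \<open>
  Take \<open>k\<close> of order \<open>(n + m) powr (2/3)\<close> in \<open>merge_near_sum\<close>. The weights lost, the multiplicity, and the at most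
  \<open>2 * k + 1\<close> steps from the size of the union to \<open>n + m\<close> all contribute at most \<open>O(k * ln (n + m))\<close> to the
  logarithm, which is below the order of \<open>(n + m) powr (3/4)\<close>.
\<close>

theorem log_almost_subadditive:
  assumes p: "0 < p" "p < 1"
  shows "\<exists>K\<ge>0. \<forall>n\<ge>1. \<forall>m\<ge>1. - ln (animal_sum p (n + m)) \<le>
    - ln (animal_sum p n) + - ln (animal_sum p m) + K * real (n + m) powr (3/4)"
proof -
  define d where "d = card S"
  have d: "d \<ge> 1" unfolding d_def by (rule card_S_pos)
  obtain C where C: "C \<ge> 1" and touchC: "\<And>n A B. A \<subseteq> carrier G \<and> finite A \<and> \<one> \<in> A \<and> card A \<le> n \<and>
      B \<subseteq> carrier G \<and> finite B \<and> \<one> \<in> B \<and> card B \<le> n \<Longrightarrow>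
      (\<exists>g\<in>carrier G. \<exists>k. real (card (A \<inter> (\<lambda>x. x \<otimes> g) ` B)) \<le> C * real n powr (2/3) \<and>
           real k \<le> C * real n powr (2/3) \<and>
           (\<exists>a\<in>A. \<exists>b\<in>B. \<exists>h\<in>word_ball k. b \<otimes> g = h \<otimes> a))"
    using nearly_touching_translate by blast
  obtain c where c: "c \<ge> 0" "\<And>n. n \<ge> 1 \<Longrightarrow>
      \<bar>ln (animal_sum p (Suc n)) - ln (animal_sum p n)\<bar> \<le> c * (1 + ln (real n))"
    using log_step_bound[OF p] by blast
  define c2 where "c2 = 1 + ln ((real d + 1) * (2 * C + 2))"
  have "1 * 1 \<le> (real d + 1) * (2 * C + 2)" using C by (intro mult_mono) auto
  then have c2: "c2 \<ge> 1" unfolding c2_def by simp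
  define rp where "rp = - ln p"
  define rq where "rq = - ln (1 - p)"
  have r: "rp \<ge> 0" "rq \<ge> 0" using p unfolding rp_def rq_def by auto
  define K where "K = (2 * (real d + 1) * C + 2) * c2 + (2 * C + 1) * (c * (1 + c2)) +
    C * rp + real d * (2 * C + 1) * rq"
  have K: "K \<ge> 0" unfolding K_def using C c(1) c2 r by (intro add_nonneg_nonneg mult_nonneg_nonneg) auto
  show ?thesis
  proof (intro exI[of _ "13 * K"] conjI allI impI)
    show "0 \<le> 13 * K" using K by simp
  next
    fix n m :: nat assume nm: "1 \<le> n" "1 \<le> m"
    define N where "N = n + m"
    define u where "u = real N powr (2/3)"
    define l where "l = 1 + ln (real N)"
    define k where "k = nat \<lfloor>C * u\<rfloor>"
    define L where "L = n + m + 2 * k + 1"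
    \<comment> \<open>dominates both \<open>L\<close> and the base \<open>d * L + 1\<close> of the multiplicity\<close>
    define V where "V = (real d + 1) * real L"
    \<comment> \<open>the cost of changing the size by at most \<open>2 * k + 1\<close>\<close>
    define D where "D = real (2 * k + 1) * (c * (1 + ln V))"
    have N: "N \<ge> 1" using nm unfolding N_def by simp
    have u: "1 \<le> u" unfolding u_def using N by (intro ge_one_powr_ge_zero) auto
    have uN: "u \<le> real N" unfolding u_def using N powr_mono[of "2/3" 1 "real N"] by simp
    have l: "1 \<le> l" unfolding l_def using N by simp
    have k: "real k \<le> C * u" unfolding k_def using C u by (simp add: of_nat_nat)
    have L1: "real L \<ge> 1" unfolding L_def by simp
    have LV: "real L \<le> V" unfolding V_def using L1 mult_right_mono[of 1 "real d + 1" "real L"] by simp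
    have V1: "V \<ge> 1" using LV L1 by linarith
    have "C * u \<le> C * real N" using uN C by (intro mult_left_mono) auto
    then have "real L \<le> (2 * C + 2) * real N"
      using k N unfolding L_def N_def by (simp add: algebra_simps)
    then have "V \<le> (real d + 1) * ((2 * C + 2) * real N)" unfolding V_def by (intro mult_left_mono) auto
    also have "\<dots> = ((real d + 1) * (2 * C + 2)) * real N" by simp
    finally have "ln V \<le> ln (((real d + 1) * (2 * C + 2)) * real N)" using V1 by (intro ln_mono) auto
    also have "\<dots> = ln ((real d + 1) * (2 * C + 2)) + ln (real N)"
      using C N by (intro ln_mult_pos) auto
    also have "\<dots> = c2 + (l - 1) - 1" unfolding c2_def l_def by simp
    also have "\<dots> \<le> c2 * l"
    proof -
      have "0 \<le> (c2 - 1) * (l - 1)" using c2 l by (intro mult_nonneg_nonneg) auto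
      then show ?thesis by (simp add: algebra_simps)
    qed
    finally have lnV: "ln V \<le> c2 * l" .
    have lnV0: "0 \<le> ln V" using V1 by simp
    have pos: "0 < animal_sum p j" if "j \<ge> 1" for j
      using animal_sum_pos[OF p, of "j - 1"] that by simp
    \<comment> \<open>all sizes that the union can have are comparable to \<open>n + m\<close>\<close>
    have near: "animal_sum p j \<le> exp D * animal_sum p N"
      if j: "1 \<le> j" "N \<le> j + k" "j \<le> L" for j
    proof -
      have st: "\<bar>ln (animal_sum p (Suc i)) - ln (animal_sum p i)\<bar> \<le> c * (1 + ln V)" if "1 \<le> i" "i < L" for i
      proof -
        have "ln (real i) \<le> ln V" using that LV by (intro ln_mono) auto
        then have "c * (1 + ln (real i)) \<le> c * (1 + ln V)" using c(1) by (intro mult_left_mono) auto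
        then show ?thesis using c(2)[OF that(1)] by linarith
      qed
      have B0: "0 \<le> c * (1 + ln V)" using c(1) lnV0 by simp
      have "N \<le> L" unfolding L_def N_def by simp
      have "\<bar>ln (animal_sum p j) - ln (animal_sum p N)\<bar> \<le> D"
      proof (cases "j \<le> N")
        case True
        have "\<bar>ln (animal_sum p N) - ln (animal_sum p j)\<bar> \<le> real (N - j) * (c * (1 + ln V))"
          by (rule abs_diff_le_steps[where f = "\<lambda>i. ln (animal_sum p i)", OF st j(1) True \<open>N \<le> L\<close>])
        also have "\<dots> \<le> D" unfolding D_def using B0 j by (intro mult_right_mono) auto
        finally show ?thesis by (simp add: abs_minus_commute)
      next
        case False
        then have "\<bar>ln (animal_sum p j) - ln (animal_sum p N)\<bar> \<le> real (j - N) * (c * (1 + ln V))"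
          by (intro abs_diff_le_steps[where f = "\<lambda>i. ln (animal_sum p i)", OF st N _ j(3)]) auto
        also have "\<dots> \<le> D" unfolding D_def using B0 j by (intro mult_right_mono) (auto simp: L_def N_def)
        finally show ?thesis .
      qed
      then have "ln (animal_sum p j) \<le> D + ln (animal_sum p N)" by linarith
      then have "exp (ln (animal_sum p j)) \<le> exp (D + ln (animal_sum p N))" by simp
      then show ?thesis using pos[OF j(1)] pos[OF N] by (simp add: exp_add)
    qed
    have glue: "\<exists>g\<in>carrier G. card (A \<inter> (\<lambda>x. x \<otimes> g) ` B) \<le> k \<and>
           (\<exists>a\<in>A. \<exists>b\<in>B. \<exists>h\<in>word_ball k. b \<otimes> g = h \<otimes> a)"
      if AB: "A \<subseteq> carrier G" "finite A" "\<one> \<in> A" "card A \<le> n + m"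
        "B \<subseteq> carrier G" "finite B" "\<one> \<in> B" "card B \<le> n + m" for A B
    proof -
      have nat_le: "i \<le> k" if "real i \<le> C * u" for i
        unfolding k_def using that by (simp add: le_nat_floor)
      obtain g k' where g: "g \<in> carrier G" "real (card (A \<inter> (\<lambda>x. x \<otimes> g) ` B)) \<le> C * u"
        "real k' \<le> C * u" "\<exists>a\<in>A. \<exists>b\<in>B. \<exists>h\<in>word_ball k'. b \<otimes> g = h \<otimes> a"
        using touchC[of A N B] AB unfolding u_def N_def by blast
      then have "card (A \<inter> (\<lambda>x. x \<otimes> g) ` B) \<le> k" "word_ball k' \<subseteq> word_ball k"
        using nat_le word_ball_mono by auto
      then show ?thesis using g(1,4) by blast
    qed
    let ?J = "{j. 1 \<le> j \<and> n + m \<le> j + k \<and> j \<le> L}"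
    let ?q = "p ^ k * (1 - p) ^ (d * (2 * k + 1))"
    let ?M = "((d * L + 1) ^ (d * k + k))\<^sup>2 * L"
    have q: "0 < ?q" using p by simp
    have "?J \<subseteq> {1..L}" by auto
    then have cJ: "card ?J \<le> L" using card_mono[of "{1..L}" ?J] by simp
    have "?q * (animal_sum p n * animal_sum p m) \<le> real ?M * (\<Sum>j\<in>?J. animal_sum p j)"
      using merge_near_sum[OF p glue] unfolding L_def d_def .
    also have "(\<Sum>j\<in>?J. animal_sum p j) \<le> (\<Sum>j\<in>?J. exp D * animal_sum p N)"
      by (intro sum_mono near) (auto simp: N_def)
    also have "\<dots> = real (card ?J) * (exp D * animal_sum p N)" by simp
    also have "\<dots> \<le> real L * (exp D * animal_sum p N)"
      using cJ pos[OF N] by (intro mult_right_mono) auto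
    finally have main: "?q * (animal_sum p n * animal_sum p m) \<le> (real ?M * real L * exp D) * animal_sum p N"
      by (simp add: mult_left_mono mult.assoc)
    have "real (d * L + 1) \<le> V" unfolding V_def using L1 by (simp add: algebra_simps)
    then have "real (d * L + 1) ^ (d * k + k) \<le> V ^ (d * k + k)" by (intro power_mono) auto
    then have "(real (d * L + 1) ^ (d * k + k))\<^sup>2 \<le> (V ^ (d * k + k))\<^sup>2" by (rule power_mono) simp
    then have "(real (d * L + 1) ^ (d * k + k))\<^sup>2 * real L * real L * exp D \<le> (V ^ (d * k + k))\<^sup>2 * V * V * exp D"
      using LV V1 by (intro mult_mono) auto
    also have "\<dots> = V ^ (2 * (d + 1) * k + 2) * exp D"
    proof -
      have "2 * (d + 1) * k + 2 = Suc (Suc ((d * k + k) * 2))" by (simp add: algebra_simps)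
      then have "V ^ (2 * (d + 1) * k + 2) = (V ^ (d * k + k))\<^sup>2 * V * V"
        by (simp only: power_Suc2 power_mult)
      then show ?thesis by (simp only:)
    qed
    finally have W: "real ?M * real L * exp D \<le> V ^ (2 * (d + 1) * k + 2) * exp D" by simp
    have "0 < ?M" by (simp add: L_def)
    then have "0 < real ?M" by (simp only: of_nat_0_less_iff)
    then have M0: "0 < real ?M * real L * exp D" using L1 by (intro mult_pos_pos) auto
    have "ln (animal_sum p n * animal_sum p m) \<le>
        ln (animal_sum p N) + ln (V ^ (2 * (d + 1) * k + 2) * exp D) - ln ?q"
      by (rule ln_le_of_weighted_le[OF main q _ pos[OF N] M0 W]) (use pos nm in auto)
    moreover have "ln (animal_sum p n * animal_sum p m) = ln (animal_sum p n) + ln (animal_sum p m)"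
      using pos[OF nm(1)] pos[OF nm(2)] by (rule ln_mult_pos)
    moreover have "ln (V ^ (2 * (d + 1) * k + 2) * exp D) = real (2 * (d + 1) * k + 2) * ln V + D"
      using V1 by (simp add: ln_mult_pos ln_realpow algebra_simps)
    moreover have "ln ?q = - (real k * rp + real (d * (2 * k + 1)) * rq)"
      using p unfolding rp_def rq_def by (simp add: ln_mult_pos ln_realpow)
    ultimately have log_main: "- ln (animal_sum p N) \<le> - ln (animal_sum p n) + - ln (animal_sum p m) +
        (real (2 * (d + 1) * k + 2) * ln V + D + real k * rp + real (d * (2 * k + 1)) * rq)" by linarith
    have ul: "u \<le> u * l" using u l mult_left_mono[of 1 l u] by auto
    have k2: "real (2 * k + 1) \<le> (2 * C + 1) * u" using k u by (simp add: algebra_simps)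
    have T1: "real (2 * (d + 1) * k + 2) * ln V \<le> ((2 * (real d + 1) * C + 2) * u) * (c2 * l)"
    proof (rule mult_mono[OF _ lnV])
      have "2 * (real d + 1) * real k \<le> 2 * (real d + 1) * (C * u)" using k by (intro mult_left_mono) auto
      then show "real (2 * (d + 1) * k + 2) \<le> (2 * (real d + 1) * C + 2) * u"
        using u by (simp add: algebra_simps)
      show "0 \<le> (2 * (real d + 1) * C + 2) * u" using C u by simp
    qed (rule lnV0)
    have T2: "D \<le> ((2 * C + 1) * u) * (c * ((1 + c2) * l))"
      unfolding D_def
    proof (rule mult_mono[OF k2])
      have "1 + ln V \<le> (1 + c2) * l" using lnV l by (simp add: algebra_simps)
      then show "c * (1 + ln V) \<le> c * ((1 + c2) * l)" using c(1) by (rule mult_left_mono)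
      show "0 \<le> (2 * C + 1) * u" using C u by simp
      show "0 \<le> c * (1 + ln V)" using c(1) lnV0 by simp
    qed
    have T3: "real k * rp \<le> (C * rp) * (u * l)"
    proof -
      have "real k * rp \<le> (C * u) * rp" using k r by (intro mult_right_mono) auto
      also have "\<dots> = (C * rp) * u" by simp
      also have "\<dots> \<le> (C * rp) * (u * l)" using ul C r by (intro mult_left_mono) auto
      finally show ?thesis .
    qed
    have T4: "real (d * (2 * k + 1)) * rq \<le> (real d * (2 * C + 1) * rq) * (u * l)"
    proof -
      have "real (d * (2 * k + 1)) * rq = (real d * rq) * real (2 * k + 1)"
        by (simp add: algebra_simps)
      also have "\<dots> \<le> (real d * rq) * ((2 * C + 1) * u)" using k2 r by (intro mult_left_mono) auto
      also have "\<dots> = (real d * (2 * C + 1) * rq) * u" by simp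
      also have "\<dots> \<le> (real d * (2 * C + 1) * rq) * (u * l)" using ul C r by (intro mult_left_mono) auto
      finally show ?thesis .
    qed
    have "real (2 * (d + 1) * k + 2) * ln V + D + real k * rp + real (d * (2 * k + 1)) * rq \<le> K * (u * l)"
      using T1 T2 T3 T4 unfolding K_def by (simp add: algebra_simps)
    \<comment> \<open>the logarithm is absorbed by \<open>ln N \<le> 12 * N powr (1/12)\<close>\<close>
    also have "u * l \<le> 13 * real N powr (3/4)"
    proof -
      have "1 \<le> real N powr (1/12)" using N by (intro ge_one_powr_ge_zero) auto
      moreover have "ln (real N) \<le> real N powr (1/12) / (1/12)" using N by (intro ln_powr_bound) auto
      ultimately have "l \<le> 13 * real N powr (1/12)" unfolding l_def by simp
      then have "u * l \<le> u * (13 * real N powr (1/12))" using u by (intro mult_left_mono) auto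
      also have "\<dots> = 13 * (real N powr (2/3) * real N powr (1/12))" unfolding u_def by simp
      also have "real N powr (2/3) * real N powr (1/12) = real N powr (3/4)"
        by (simp add: powr_add[symmetric])
      finally show ?thesis .
    qed
    then have "K * (u * l) \<le> K * (13 * real N powr (3/4))" using K by (rule mult_left_mono)
    finally have "real (2 * (d + 1) * k + 2) * ln V + D + real k * rp + real (d * (2 * k + 1)) * rq
        \<le> 13 * K * real N powr (3/4)" by simp
    then show "- ln (animal_sum p (n + m)) \<le>
      - ln (animal_sum p n) + - ln (animal_sum p m) + 13 * K * real (n + m) powr (3/4)"
      using log_main unfolding N_def by linarith
  qed
qed

end

theorem theorem1:
  fixes G :: "('a, 'b) monoid_scheme" and S :: "'a set" and p :: real
  assumes "group G" and "infinite (carrier G)"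
    and "finite S" and "S \<subseteq> carrier G"
    and "S = (\<lambda>s. inv\<^bsub>G\<^esub> s) ` S"
    and "generate G S = carrier G"
    and "0 < p" and "p < 1"
  shows "convergent (\<lambda>n. - (1 / real n) * ln (cluster_size_prob G S p n))"
proof -
  interpret cayley_graph G S
    using assms(1-6) unfolding cayley_graph_def cayley_graph_axioms_def by blast
  have p: "0 \<le> p" "p \<le> 1" using assms(7,8) by auto
  have eq: "cluster_size_prob G S p n = animal_sum p n" for n
    unfolding animal_sum_def by (rule cluster_size_prob_eq_sum[OF p])
  interpret P: prob_space "bond_percolation (cayley_edges G S) p"
    unfolding bond_percolation_def by (intro prob_space_PiM) unfold_locales
  have le1: "animal_sum p n \<le> 1" for n
    unfolding eq[symmetric] cluster_size_prob_def by (rule P.prob_le_1)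
  obtain K where K: "K \<ge> 0" "\<And>n m. n \<ge> 1 \<Longrightarrow> m \<ge> 1 \<Longrightarrow> - ln (animal_sum p (n + m)) \<le>
      - ln (animal_sum p n) + - ln (animal_sum p m) + K * real (n + m) powr (3/4)"
    using log_almost_subadditive[OF assms(7,8)] by blast
  have "convergent (\<lambda>n. - ln (animal_sum p n) / real n)"
  proof (rule almost_subadditive_convergent[OF K(2) _ K(1)])
    fix n :: nat assume "n \<ge> 1"
    then have "0 < animal_sum p n" using animal_sum_pos[OF assms(7,8), of "n - 1"] by simp
    then show "0 \<le> - ln (animal_sum p n)" using le1[of n] by simp
  qed auto
  then show ?thesis unfolding eq by simp
qed

end
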